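(* Let $r\ge1$ and let $\underline{a}=0,a_1,\ldots,a_r$ be an $(n,r)$-composition with $a_0=0$. Then $$\bar\gamma(0,a_1,\ldots,a_r;x,y)=f_r(\underline{a})\,T(U_{r,n};x,y)+(xy-x-y)\sum_{k=1}^{r-1}(x-1)^{r-k-1}\left(\sum_{h=0}^{k-1}(-1)^h f_{k,k-h}(\underline{a})\,\tau(k+1,\xi_{k-h}-k-1;y)\right).$$
   Context: An $(n,r)$-composition is an integer sequence $\underline{a}=a_0,a_1,\ldots,a_r$ with $a_0\ge 0$, $a_i\ge 1$ for $1\le i\le r$, and $a_0+\cdots+a_r=n$. It is identified with the bit sequence $0^{a_0}10^{a_1-1}\cdots 10^{a_r-1}$ of length $n$ with exactly $r$ ones (an $(n,r)$-sequence). $\underline{b}\trianglerighteq\underline{a}$ means that every initial segment of $\underline{b}$ contains at least as many $1$'s as the initial segment of $\underline{a}$ of the same length. Partial sums: $\xi_i=a_0+a_1+\cdots+a_i$. $\mathcal{G}(n,r)$ is the vector space, over a field of characteristic zero, with basis the formal symbols $[\underline{b}]$, one for each $(n,r)$-sequence. The linear map $\mathsf{Sp}$ from $\mathcal{G}(n,r)$ to polynomials in $x,y$ is given by $$[r_1\cdots r_n]\mapsto\frac1{n!}\sum_{m=0}^n\binom nm (x-1)^{r-w_m}(y-1)^{m-w_m},\qquad w_m=r_1+\cdots+r_m .$$ With $(t)_k=t(t-1)\cdots(t-k+1)$, $$\gamma(\underline{a})=\sum_{\underline{b}\trianglerighteq\underline{a}}(a_0)_{b_0}\prod_{j=1}^r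 a_j\Big(a_j-1+\sum_{i=0}^{j-1}(a_i-b_i)\Big)_{b_j-1}[0^{b_0}10^{b_1-1}\cdots10^{b_r-1}],$$ and $\bar\gamma(\underline{a};x,y)=\mathsf{Sp}(\gamma(\underline{a}))$. $U_{r,n}$ is the uniform matroid of rank $r$ on $n$ elements, and $T$ denotes the Tutte polynomial: $T(M;x,y)=\sum_{A\subseteq S}(x-1)^{r-\mathrm{rk}(A)}(y-1)^{|A|-\mathrm{rk}(A)}$. For $d\ge1$, $\alpha\ge0$: $\tau(d,\alpha;y)=\sum_{i=0}^{\alpha}\binom{\alpha+d-1-i}{\alpha-i}y^i$; and $\tau(d,\alpha;y)=0$ if $d\le 0$ or $\alpha<0$. Write $a_{i:j}=a_{j:i}=a_i+a_{i+1}+\cdots+a_j$ for $i\le j$. Define $$\nu(0,c_1,\ldots,c_s)=\frac{(c_1+\cdots+c_s)(c_2+\cdots+c_s)\cdots(c_{s-1}+c_s)}{c_1c_2\cdots c_{s-1}}$$ (equal to $1$ when $s\le 1$) and $$f_k(\underline{a})=\frac1{\nu(0,a_1,\ldots,a_k)\,\nu(0,a_{k+1},\ldots,a_r)}$$ (so $f_r(\underline{a})=1/\nu(0,a_1,\ldots,a_r)$). Set $f_{k,k}(\underline{a})=f_k(\underline{a})$ and, for $1\le h\le k-1$, $f_{k,k-h}(\underline{a})=m_{k,k-h}(\underline{a})f_{k-h}(\underline{a})$ with $$m_{k,k-h}(\underline{a})=\frac{a_{r:k+1}\,a_{r:k}\cdots a_{r:k-h+2}}{a_{k:k-h+1}\,a_{k-1:k-h+1}\cdots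 a_{k-h+1:k-h+1}}$$ ($h$ factors in the numerator and $h$ in the denominator). *)

theory Defs
  imports
    Complex_Main
    "HOL-Library.Poly_Mapping"
    "HOL-Computational_Algebra.Polynomial"
begin

text \<open>
  A sequence \<open>a\<^sub>0, \<dots>, a\<^sub>r\<close> is the list \<open>[a\<^sub>0, \<dots>, a\<^sub>r]\<close>, so that \<open>a ! i\<close> is \<open>a\<^sub>i\<close>
  and \<open>length a = r + 1\<close>.
\<close>

definition composition :: "nat \<Rightarrow> nat \<Rightarrow> nat list \<Rightarrow> bool" where
  "composition n r a \<longleftrightarrow> length a = r + 1 \<and> (\<forall>i\<in>{1..r}. a ! i \<ge> 1) \<and> sum_list a = n"

definition bits :: "nat list \<Rightarrow> bool list" where
  "bits a = replicate (hd a) False @ concat (map (\<lambda>c. True # replicate (c - 1) False) (tl a))"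

definition ones :: "bool list \<Rightarrow> nat" where
  "ones w = count_list w True"

definition nr_sequences :: "nat \<Rightarrow> nat \<Rightarrow> bool list set" where
  "nr_sequences n r = {w. length w = n \<and> ones w = r}"

definition dominates :: "bool list \<Rightarrow> bool list \<Rightarrow> bool"  (infix \<open>\<unrhd>\<close> 50) where
  "v \<unrhd> w \<longleftrightarrow> length v = length w \<and> (\<forall>m\<le>length w. ones (take m v) \<ge> ones (take m w))"

definition xi :: "nat list \<Rightarrow> nat \<Rightarrow> nat" where
  "xi a i = (\<Sum>j=0..i. a ! j)"

text \<open>
  The polynomial ring \<open>K[x,y]\<close> is represented as \<open>K[y][x]\<close>.
\<close>

definition var_x :: "'a::comm_ring_1 poly poly" where
  "var_x = [:0, 1:]"

definition var_y :: "'a::comm_ring_1 poly poly" where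
  "var_y = [:[:0, 1:]:]"

definition const_xy :: "'a::comm_ring_1 \<Rightarrow> 'a poly poly" where
  "const_xy c = [:[:c:]:]"

text \<open>
  Finitely supported functions on bit lists are the formal linear combinations of bit
  lists; the basis symbol \<open>[w]\<close> is \<^term>\<open>Poly_Mapping.single w 1\<close>.
\<close>

definition G_space :: "nat \<Rightarrow> nat \<Rightarrow> (bool list \<Rightarrow>\<^sub>0 'a::field_char_0) set" where
  "G_space n r = {v. Poly_Mapping.keys v \<subseteq> nr_sequences n r}"

definition Sp_basis :: "nat \<Rightarrow> nat \<Rightarrow> bool list \<Rightarrow> 'a::field_char_0 poly poly" where
  "Sp_basis n r w = const_xy (1 / fact n) *
     (\<Sum>m=0..n. of_nat (n choose m) *
        (var_x - 1) ^ (r - ones (take m w)) * (var_y - 1) ^ (m - ones (take m w)))"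

definition Sp :: "nat \<Rightarrow> nat \<Rightarrow> (bool list \<Rightarrow>\<^sub>0 'a::field_char_0) \<Rightarrow> 'a poly poly" where
  "Sp n r v = (\<Sum>w\<in>Poly_Mapping.keys v. const_xy (Poly_Mapping.lookup v w) * Sp_basis n r w)"

lemma Sp_single: "Sp n r (Poly_Mapping.single w c) = const_xy c * Sp_basis n r w"
  by (simp add: Sp_def const_xy_def)

lemma Sp_add:
  fixes u v :: "bool list \<Rightarrow>\<^sub>0 'a::field_char_0"
  shows "Sp n r (u + v) = Sp n r u + Sp n r v"
proof -
  let ?K = "Poly_Mapping.keys u \<union> Poly_Mapping.keys v"
  have ext: "Sp n r z = (\<Sum>w\<in>?K. const_xy (Poly_Mapping.lookup z w) * Sp_basis n r w)"
    if "Poly_Mapping.keys z \<subseteq> ?K" for z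
    unfolding Sp_def using that
    by (intro sum.mono_neutral_left) (auto simp: in_keys_iff const_xy_def)
  have "Poly_Mapping.keys (u + v) \<subseteq> ?K"
    by (rule Poly_Mapping.keys_add)
  moreover have "const_xy (c + d) = const_xy c + const_xy d" for c d :: 'a
    by (simp add: const_xy_def)
  ultimately show ?thesis
    by (simp add: ext lookup_add sum.distrib distrib_right)
qed

definition falling :: "'a::comm_ring_1 \<Rightarrow> nat \<Rightarrow> 'a" where
  "falling t k = (\<Prod>i<k. t - of_nat i)"

definition gamma_coeff :: "nat \<Rightarrow> nat list \<Rightarrow> nat list \<Rightarrow> int" where
  "gamma_coeff r a b = falling (int (a ! 0)) (b ! 0) *
     (\<Prod>j=1..r. int (a ! j) *
        falling (int (a ! j) - 1 + (\<Sum>i=0..j-1. int (a ! i) - int (b ! i))) (b ! j - 1))"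

definition gamma_elem :: "nat \<Rightarrow> nat \<Rightarrow> nat list \<Rightarrow> (bool list \<Rightarrow>\<^sub>0 'a::field_char_0)" where
  "gamma_elem n r a = (\<Sum>b | composition n r b \<and> bits b \<unrhd> bits a.
     Poly_Mapping.single (bits b) (of_int (gamma_coeff r a b)))"

lemma bits_in_nr_sequences:
  assumes "composition n r a"
  shows "bits a \<in> nr_sequences n r"
proof -
  obtain c cs where a: "a = c # cs"
    using assms by (cases a) (auto simp: composition_def)
  have pos: "\<forall>d\<in>set cs. d \<ge> 1"
  proof
    fix d assume "d \<in> set cs"
    then obtain i where i: "i < length cs" "d = cs ! i"
      by (auto simp: in_set_conv_nth)
    then have "Suc i \<in> {1..r}" "a ! Suc i = d"
      using assms a by (auto simp: composition_def)
    then show "d \<ge> 1"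
      using assms by (auto simp: composition_def)
  qed
  have rep: "count_list (replicate k False) True = 0" for k
    by (induction k) auto
  have "count_list (concat (map (\<lambda>c. True # replicate (c - 1) False) cs)) True = length cs"
    by (induction cs) (auto simp: rep)
  moreover have "length (concat (map (\<lambda>c. True # replicate (c - 1) False) cs)) = sum_list cs"
    using pos by (induction cs) auto
  ultimately show ?thesis
    using assms a by (auto simp: nr_sequences_def ones_def bits_def composition_def rep)
qed

lemma gamma_elem_in_G_space: "gamma_elem n r a \<in> G_space n r"
proof -
  have "Poly_Mapping.keys (gamma_elem n r a) \<subseteq>
      (\<Union>b\<in>{b. composition n r b \<and> bits b \<unrhd> bits a}. {bits b})"
    unfolding gamma_elem_def by (rule order_trans[OF keys_sum]) auto
  then show ?thesis
    using bits_in_nr_sequences by (fastforce simp: G_space_def)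
qed

definition gamma_bar :: "nat \<Rightarrow> nat \<Rightarrow> nat list \<Rightarrow> 'a::field_char_0 poly poly" where
  "gamma_bar n r a = Sp n r (gamma_elem n r a)"

locale matroid =
  fixes S :: "'e set" and indep :: "'e set \<Rightarrow> bool"
  assumes finite_carrier: "finite S"
    and indep_subset_carrier: "indep A \<Longrightarrow> A \<subseteq> S"
    and indep_empty: "indep {}"
    and indep_subset: "indep A \<Longrightarrow> B \<subseteq> A \<Longrightarrow> indep B"
    and indep_augment:
      "indep A \<Longrightarrow> indep B \<Longrightarrow> card A < card B \<Longrightarrow> \<exists>e\<in>B - A. indep (insert e A)"

definition rank_of :: "('e set \<Rightarrow> bool) \<Rightarrow> 'e set \<Rightarrow> nat" where
  "rank_of indep A = Max {card B |B. B \<subseteq> A \<and> indep B}"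

definition tutte :: "'e set \<Rightarrow> ('e set \<Rightarrow> bool) \<Rightarrow> 'a::field_char_0 poly poly" where
  "tutte S indep = (\<Sum>A\<in>Pow S.
     (var_x - 1) ^ (rank_of indep S - rank_of indep A) * (var_y - 1) ^ (card A - rank_of indep A))"

definition uniform_indep :: "nat \<Rightarrow> nat \<Rightarrow> nat set \<Rightarrow> bool" where
  "uniform_indep r n A \<longleftrightarrow> A \<subseteq> {..<n} \<and> card A \<le> r"

lemma matroid_uniform: "matroid {..<n} (uniform_indep r n)"
proof
  fix A B :: "nat set"
  assume A: "uniform_indep r n A" and B: "uniform_indep r n B" and less: "card A < card B"
  have fin: "finite A" "finite B"
    using A B by (auto simp: uniform_indep_def intro: finite_subset)
  then have "\<not> B \<subseteq> A"
    using less card_mono[of A B] by auto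
  then obtain e where "e \<in> B - A" by blast
  then show "\<exists>e\<in>B - A. uniform_indep r n (insert e A)"
    using A B less fin by (intro bexI[of _ e]) (auto simp: uniform_indep_def)
next
  fix A B :: "nat set"
  assume "uniform_indep r n A" and sub: "B \<subseteq> A"
  moreover from this have "finite A"
    by (auto simp: uniform_indep_def intro: finite_subset)
  ultimately show "uniform_indep r n B"
    using card_mono[of A B] by (auto simp: uniform_indep_def)
qed (auto simp: uniform_indep_def)

definition tutte_uniform :: "nat \<Rightarrow> nat \<Rightarrow> 'a::field_char_0 poly poly" where
  "tutte_uniform r n = tutte {..<n} (uniform_indep r n)"

definition tau :: "int \<Rightarrow> int \<Rightarrow> 'a::field_char_0 poly poly" where
  "tau d \<alpha> = (if d \<ge> 1 \<and> \<alpha> \<ge> 0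
     then \<Sum>i=0..nat \<alpha>. of_nat (nat (\<alpha> + d - 1 - int i) choose nat (\<alpha> - int i)) * var_y ^ i
     else 0)"

definition seg :: "nat list \<Rightarrow> nat \<Rightarrow> nat \<Rightarrow> nat" where
  "seg a i j = (\<Sum>l=min i j..max i j. a ! l)"

text \<open>
  \<open>nu [c\<^sub>1, \<dots>, c\<^sub>s]\<close> is \<open>\<nu>(0, c\<^sub>1, \<dots>, c\<^sub>s)\<close>: the leading zero is not part of the list.
\<close>

definition nu :: "nat list \<Rightarrow> 'a::field_char_0" where
  "nu c = (\<Prod>i<length c - 1. of_nat (sum_list (drop i c))) / (\<Prod>i<length c - 1. of_nat (c ! i))"

definition f_coeff :: "nat list \<Rightarrow> nat \<Rightarrow> 'a::field_char_0" where
  "f_coeff a k = 1 / (nu (take k (tl a)) * nu (drop k (tl a)))"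

text \<open>
  Both products below have \<open>h = k - l\<close> factors; here \<open>r\<close> is \<open>length a - 1\<close>.
\<close>

definition m_quot :: "nat list \<Rightarrow> nat \<Rightarrow> nat \<Rightarrow> 'a::field_char_0" where
  "m_quot a k l = (\<Prod>j=l+2..k+1. of_nat (seg a (length a - 1) j)) / (\<Prod>j=l+1..k. of_nat (seg a j (l + 1)))"

definition f_quot :: "nat list \<Rightarrow> nat \<Rightarrow> nat \<Rightarrow> 'a::field_char_0" where
  "f_quot a k l = (if l = k then f_coeff a k else m_quot a k l * f_coeff a l)"

end

(*
  The coefficient of a bit sequence in gamma(a) is a product of one factor per bit, where a bit
  depends only on its position and on the number of ones before it. Cutting each sequence after
  m bits therefore factors the sum over all sequences with w_m = j into a prefix sum and a suffix
  sum, and both are determined by linear recurrences in m. With the nodes A_i = xi_i, the suffix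
  sum is (n-m)! / nu(0, a_{j+1}, ..., a_r) for m <= A_j, while the prefix sum (zero for m > A_j) is
  m! a_1 ... a_j times the divided difference of the polynomial t |-> (t choose m) at
  A_0, ..., A_j. This computes the coefficients of gamma-bar in powers of x-1 and y-1.

  The numbers (-1)^h f_{k,k-h} are, up to a common factor, the Lagrange weights at A_{k-h} for the
  nodes A_0, ..., A_k, A_r. So the inner sum of the theorem is a divided difference at these nodes
  without its term at A_r, which is the contribution of T(U_{r,n}). As
  xy-x-y = (x-1)(y-1) - 1, the claim is the recurrence expressing the divided difference at
  A_0, ..., A_j, A_r by those with A_j or A_r removed, together with the vanishing of the divided
  difference of (t choose j) at these j+2 nodes.
*)

theory Submission
  imports Defs
begin

subsection \<open>Divided differences\<close>

text \<open>The Lagrange form of the divided difference of \<open>q\<close>. The nodes form a set,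
  so symmetry is built in and removing a node is set difference; without nodes the value is
  0.\<close>

definition divdiff :: "'a::field set \<Rightarrow> ('a \<Rightarrow> 'a) \<Rightarrow> 'a" where
  "divdiff S q = (\<Sum>x\<in>S. q x * (\<Prod>z\<in>S - {x}. inverse (x - z)))"

lemma divdiff_add: "divdiff S (\<lambda>x. p x + q x) = divdiff S p + divdiff S q"
  by (simp add: divdiff_def sum.distrib distrib_right)

lemma divdiff_cmult: "divdiff S (\<lambda>x. c * q x) = c * divdiff S q"
  by (simp add: divdiff_def sum_distrib_left mult.assoc)

text \<open>The factor x - t kills the term at t and cancels the factor 1 / (x - t) of every other
  weight.\<close>

lemma divdiff_mult_node:
  assumes "finite S" "t \<in> S"
  shows "divdiff S (\<lambda>x. (x - t) * q x) = divdiff (S - {t}) q"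
proof -
  have "divdiff S (\<lambda>x. (x - t) * q x) =
      (\<Sum>x\<in>S - {t}. (x - t) * q x * (\<Prod>z\<in>S - {x}. inverse (x - z)))"
    unfolding divdiff_def by (simp add: sum.remove[OF assms])
  also have "\<dots> = (\<Sum>x\<in>S - {t}. q x * (\<Prod>z\<in>S - {t} - {x}. inverse (x - z)))"
  proof (rule sum.cong[OF refl])
    fix x assume x: "x \<in> S - {t}"
    have "(\<Prod>z\<in>S - {x}. inverse (x - z)) =
        inverse (x - t) * (\<Prod>z\<in>S - {x} - {t}. inverse (x - z))"
      using assms x by (intro prod.remove) auto
    moreover have "S - {x} - {t} = S - {t} - {x}" by blast
    ultimately show "(x - t) * q x * (\<Prod>z\<in>S - {x}. inverse (x - z)) =
        q x * (\<Prod>z\<in>S - {t} - {x}. inverse (x - z))"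
      using x by simp
  qed
  finally show ?thesis by (simp add: divdiff_def)
qed

text \<open>Write x - t = (s - t) + (x - s); the factor x - t removes the node t, the factor x - s
  the node s.\<close>

lemma divdiff_node_difference:
  assumes "finite S" "s \<in> S" "t \<in> S"
  shows "(s - t) * divdiff S q = divdiff (S - {t}) q - divdiff (S - {s}) q"
proof -
  have "divdiff S (\<lambda>x. (s - t) * q x + (x - s) * q x) = divdiff S (\<lambda>x. (x - t) * q x)"
    by (simp add: algebra_simps)
  then have "(s - t) * divdiff S q + divdiff (S - {s}) q = divdiff (S - {t}) q"
    by (simp only: divdiff_add divdiff_cmult divdiff_mult_node[OF assms(1,2)]
        divdiff_mult_node[OF assms(1,3)])
  then show ?thesis by (simp add: algebra_simps)
qed

text \<open>Removing s or t gives the same value, namely 1 when one node remains and 0 by induction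
  otherwise, so the node recurrence can be divided by s - t.\<close>

lemma divdiff_one_eq_0:
  assumes "finite S" "card S \<ge> 2"
  shows "divdiff S (\<lambda>_. 1) = 0"
  using assms
proof (induction "card S" arbitrary: S rule: less_induct)
  case less
  obtain s t where st: "s \<in> S" "t \<in> S" "s \<noteq> t"
    using less.prems by (metis One_nat_def Suc_1 card_le_Suc0_iff_eq not_less_eq_eq)
  have "divdiff (S - {t}) (\<lambda>_. 1) = divdiff (S - {s}) (\<lambda>_. 1)"
  proof (cases "card S = 2")
    case True
    then have "S = {s, t}"
      using st less.prems by (intro card_subset_eq[symmetric]) auto
    then have "S - {t} = {s}" "S - {s} = {t}" using st by auto
    then show ?thesis by (simp add: divdiff_def)
  next
    case False
    then have "divdiff (S - {u}) (\<lambda>_. 1) = 0" if "u \<in> S" for u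
      using less.prems that by (intro less.hyps) (auto simp: card_gt_0_iff)
    then show ?thesis using st by simp
  qed
  then show ?case
    using divdiff_node_difference[OF less.prems(1) st(1,2), of "\<lambda>_. 1"] st(3) by simp
qed

text \<open>Splits x - m = (x - t) + (t - m) in (m + 1) (x choose m + 1) = (x - m) (x choose m); the
  first part removes the node t.\<close>

lemma divdiff_gbinomial_Suc:
  fixes t :: "'a::field_char_0"
  assumes "finite S" "t \<in> S"
  shows "of_nat (Suc m) * divdiff S (\<lambda>x. x gchoose Suc m) =
    divdiff (S - {t}) (\<lambda>x. x gchoose m) + (t - of_nat m) * divdiff S (\<lambda>x. x gchoose m)"
proof -
  have "of_nat (Suc m) * (x gchoose Suc m) =
      (x - t) * (x gchoose m) + (t - of_nat m) * (x gchoose m)" for x :: 'a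
    using gbinomial_mult_1[of x m] by (simp add: algebra_simps)
  then have "divdiff S (\<lambda>x. of_nat (Suc m) * (x gchoose Suc m)) =
      divdiff S (\<lambda>x. (x - t) * (x gchoose m) + (t - of_nat m) * (x gchoose m))"
    by presburger
  then show ?thesis
    by (simp only: divdiff_add divdiff_cmult divdiff_mult_node[OF assms])
qed

text \<open>The recurrence lowers the degree by one and removes at most one node, so enough nodes
  remain for the induction.\<close>

lemma divdiff_gbinomial_eq_0:
  fixes S :: "'a::field_char_0 set"
  assumes "finite S" "m + 1 < card S"
  shows "divdiff S (\<lambda>x. x gchoose m) = 0"
  using assms
proof (induction m arbitrary: S)
  case 0
  then show ?case using divdiff_one_eq_0[of S] by simp
next
  case (Suc m)
  then obtain t where t: "t \<in> S" by (metis card.empty ex_in_conv not_less_zero)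
  have "of_nat (Suc m) * divdiff S (\<lambda>x. x gchoose Suc m) = 0"
    unfolding divdiff_gbinomial_Suc[OF Suc.prems(1) t]
    using Suc.IH[of S] Suc.IH[of "S - {t}"] Suc.prems t by auto
  then show ?case by (metis mult_eq_0_iff of_nat_eq_0_iff nat.distinct(2))
qed

subsection \<open>Bit sequences\<close>

lemma ones_simps [simp]:
  "ones [] = 0" "ones (True # w) = Suc (ones w)" "ones (False # w) = ones w"
  "ones (u @ v) = ones u + ones v"
  by (simp_all add: ones_def)

lemma ones_replicate_False [simp]: "ones (replicate k False) = 0"
  by (induction k) auto

lemma ones_le_length: "ones w \<le> length w"
  by (simp add: ones_def count_le_length)

lemma finite_nr_sequences [simp]: "finite (nr_sequences n r)"
  by (rule finite_subset[OF _ finite_lists_length_eq[of UNIV n]]) (auto simp: nr_sequences_def)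

lemma nr_sequences_0: "nr_sequences 0 r = (if r = 0 then {[]} else {})"
  by (auto simp: nr_sequences_def)

lemma sum_nr_sequences_Cons:
  "sum f (nr_sequences (Suc n) r) = (\<Sum>w\<in>nr_sequences n r. f (False # w)) +
     (if r = 0 then 0 else \<Sum>w\<in>nr_sequences n (r - 1). f (True # w))"
proof -
  have "nr_sequences (Suc n) r = Cons False ` nr_sequences n r \<union>
      (if r = 0 then {} else Cons True ` nr_sequences n (r - 1))" (is "_ = ?L \<union> ?R")
  proof (intro equalityI subsetI)
    fix w assume w: "w \<in> nr_sequences (Suc n) r"
    then obtain c v where "w = c # v" by (cases w) (auto simp: nr_sequences_def)
    with w show "w \<in> ?L \<union> ?R" by (cases c) (auto simp: nr_sequences_def)
  qed (auto simp: nr_sequences_def split: if_splits)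
  moreover have "sum f (?L \<union> ?R) = sum f ?L + sum f ?R"
    by (rule sum.union_disjoint) auto
  moreover have "inj_on (Cons c) A" for c :: bool and A by simp
  ultimately show ?thesis by (simp add: sum.reindex)
qed

lemma sum_nr_sequences_snoc:
  "sum f (nr_sequences (Suc n) r) = (\<Sum>w\<in>nr_sequences n r. f (w @ [False])) +
     (if r = 0 then 0 else \<Sum>w\<in>nr_sequences n (r - 1). f (w @ [True]))"
proof -
  have "nr_sequences (Suc n) r = (\<lambda>w. w @ [False]) ` nr_sequences n r \<union>
      (if r = 0 then {} else (\<lambda>w. w @ [True]) ` nr_sequences n (r - 1))" (is "_ = ?L \<union> ?R")
  proof (intro equalityI subsetI)
    fix w assume w: "w \<in> nr_sequences (Suc n) r"
    then obtain c v where "w = v @ [c]" by (cases w rule: rev_cases) (auto simp: nr_sequences_def)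
    with w show "w \<in> ?L \<union> ?R" by (cases c) (auto simp: nr_sequences_def)
  qed (auto simp: nr_sequences_def split: if_splits)
  moreover have "sum f (?L \<union> ?R) = sum f ?L + sum f ?R"
    by (rule sum.union_disjoint) auto
  moreover have "inj_on (\<lambda>w. w @ [c]) A" for c :: bool and A by (simp add: inj_on_def)
  ultimately show ?thesis by (simp add: sum.reindex)
qed

lemma sum_nr_sequences_split:
  assumes "m \<le> n"
  shows "(\<Sum>w\<in>nr_sequences n r. f (take m w) (drop m w)) =
    (\<Sum>j\<le>min m r. \<Sum>u\<in>nr_sequences m j. \<Sum>v\<in>nr_sequences (n - m) (r - j). f u v)"
proof -
  have "(\<Sum>j\<le>min m r. \<Sum>u\<in>nr_sequences m j. \<Sum>v\<in>nr_sequences (n - m) (r - j). f u v) =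
      (\<Sum>(j, u, v)\<in>(SIGMA j:{..min m r}. nr_sequences m j \<times> nr_sequences (n - m) (r - j)). f u v)"
    by (simp add: sum.Sigma sum.cartesian_product)
  also have "\<dots> = (\<Sum>w\<in>nr_sequences n r. f (take m w) (drop m w))"
  proof (rule sum.reindex_bij_witness[of _ "\<lambda>w. (ones (take m w), take m w, drop m w)"
        "\<lambda>(j, u, v). u @ v"])
    fix w assume w: "w \<in> nr_sequences n r"
    have "ones w = ones (take m w) + ones (drop m w)"
      by (metis append_take_drop_id ones_simps(4))
    then show "(ones (take m w), take m w, drop m w)
        \<in> (SIGMA j:{..min m r}. nr_sequences m j \<times> nr_sequences (n - m) (r - j))"
      using w assms ones_le_length[of "take m w"] by (auto simp: nr_sequences_def)
  qed (use assms in \<open>auto simp: nr_sequences_def\<close>)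
  finally show ?thesis ..
qed

lemma ones_take_mono: "i \<le> j \<Longrightarrow> ones (take i w) \<le> ones (take j w)"
  by (metis le_add1 le_add_diff_inverse ones_simps(4) take_add)

section \<open>Compositions as bit sequences\<close>

definition blocks :: "nat list \<Rightarrow> bool list" where
  "blocks cs = concat (map (\<lambda>c. True # replicate (c - 1) False) cs)"

lemma blocks_simps [simp]:
  "blocks [] = []" "blocks (c # cs) = True # replicate (c - 1) False @ blocks cs"
  "blocks (bs @ cs) = blocks bs @ blocks cs"
  by (simp_all add: blocks_def)

lemma bits_Cons [simp]: "bits (c # cs) = replicate c False @ blocks cs"
  by (simp add: bits_def blocks_def)

lemma ones_blocks [simp]: "ones (blocks cs) = length cs"
  by (induction cs) auto

lemma length_blocks: "\<forall>c\<in>set cs. 1 \<le> c \<Longrightarrow> length (blocks cs) = sum_list cs"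
  by (induction cs) auto

lemma composition_Cons_iff:
  "composition n r (c # cs) \<longleftrightarrow> length cs = r \<and> (\<forall>d\<in>set cs. 1 \<le> d) \<and> c + sum_list cs = n"
proof -
  have "(\<forall>i\<in>{1..r}. 1 \<le> (c # cs) ! i) \<longleftrightarrow> (\<forall>d\<in>set cs. 1 \<le> d)" if "length cs = r"
  proof -
    have "(\<forall>i\<in>{1..r}. 1 \<le> (c # cs) ! i) \<longleftrightarrow> (\<forall>i\<in>Suc ` {..<r}. 1 \<le> (c # cs) ! i)"
      by (simp add: image_Suc_lessThan)
    then show ?thesis using that by (auto simp: all_set_conv_all_nth)
  qed
  then show ?thesis by (auto simp: composition_def)
qed

lemma compositionE:
  assumes "composition n r b"
  obtains c cs where "b = c # cs" "length cs = r" "\<forall>d\<in>set cs. 1 \<le> d" "c + sum_list cs = n"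
  using assms by (cases b) (auto simp: composition_Cons_iff, auto simp: composition_def)

text \<open>The inverse of \<open>bits\<close>. A leading one forms a part together with the zeros
  counted by the head of the rest, and a new head 0 is put in front.\<close>

fun composition_of :: "bool list \<Rightarrow> nat list" where
  "composition_of [] = [0]"
| "composition_of (True # w) = 0 # Suc (hd (composition_of w)) # tl (composition_of w)"
| "composition_of (False # w) = Suc (hd (composition_of w)) # tl (composition_of w)"

lemma composition_of_replicate_False:
  "composition_of (replicate k False @ w) = (k + hd (composition_of w)) # tl (composition_of w)"
proof (induction k)
  case 0
  have "composition_of w \<noteq> []" by (induction w rule: composition_of.induct) auto
  then show ?case by simp
qed auto

lemma composition_of_blocks: "\<forall>c\<in>set cs. 1 \<le> c \<Longrightarrow> composition_of (blocks cs) = 0 # cs"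
  by (induction cs) (auto simp: composition_of_replicate_False)

lemma composition_composition_of: "composition (length w) (ones w) (composition_of w)"
proof (induction w rule: composition_of.induct)
  case 1
  then show ?case by (simp add: composition_Cons_iff)
next
  case (2 w)
  then show ?case by (elim compositionE) (auto simp: composition_Cons_iff)
next
  case (3 w)
  then show ?case by (elim compositionE) (auto simp: composition_Cons_iff)
qed

lemma bits_composition_of: "bits (composition_of w) = w"
proof (induction w rule: composition_of.induct)
  case (2 w)
  then show ?case using composition_composition_of[of w] by (elim compositionE) auto
next
  case (3 w)
  then show ?case using composition_composition_of[of w] by (elim compositionE) auto
qed auto

lemma bij_betw_bits: "bij_betw bits {b. composition n r b} (nr_sequences n r)"
proof (rule bij_betw_byWitness[where f' = composition_of])
  show "\<forall>b\<in>{b. composition n r b}. composition_of (bits b) = b"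
    by (auto elim!: compositionE simp: composition_of_replicate_False composition_of_blocks)
  show "composition_of ` nr_sequences n r \<subseteq> {b. composition n r b}"
    using composition_composition_of by (auto simp: nr_sequences_def)
qed (auto simp: bits_composition_of bits_in_nr_sequences)

subsection \<open>The coefficients of gamma as weights of bit sequences\<close>

text \<open>
  With \<open>p\<close> bits and \<open>j\<close> ones already read, every further zero contributes one linear factor
  of the falling factorials in \<^const>\<open>gamma_coeff\<close>, so that these coefficients become
  multiplicative under concatenation.
\<close>

fun bit_weight :: "nat list \<Rightarrow> nat \<Rightarrow> nat \<Rightarrow> bool list \<Rightarrow> 'a::comm_ring_1" where
  "bit_weight a p j [] = 1"
| "bit_weight a p j (True # w) = of_nat (a ! Suc j) * bit_weight a (Suc p) (Suc j) w"
| "bit_weight a p j (False # w) = (of_nat (xi a j) - of_nat p) * bit_weight a (Suc p) j w"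

lemma bit_weight_append:
  "bit_weight a p j (u @ v) = bit_weight a p j u * bit_weight a (p + length u) (j + ones u) v"
  by (induction a p j u rule: bit_weight.induct) (auto simp: mult.assoc)

lemma falling_Suc: "falling t (Suc k) = t * falling (t - 1) k"
  by (simp add: falling_def prod.lessThan_Suc_shift algebra_simps del: prod.lessThan_Suc)

lemma of_int_falling: "of_int (falling t k) = falling (of_int t) k"
  by (simp add: falling_def)

lemma bit_weight_replicate_False:
  "bit_weight a p j (replicate k False) = falling (of_nat (xi a j) - of_nat p) k"
proof (induction k arbitrary: p)
  case (Suc k)
  then show ?case by (simp add: falling_Suc diff_diff_eq add.commute)
qed (simp add: falling_def)

lemma xi_eq_sum_list: "i < length a \<Longrightarrow> xi a i = sum_list (take (Suc i) a)"
  by (simp add: xi_def sum_list_sum_nth atLeast0AtMost atLeast0LessThan lessThan_Suc_atMost min_absorb2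
      del: sum.lessThan_Suc)

lemma xi_Suc: "xi a (Suc i) = xi a i + a ! Suc i"
  by (simp add: xi_def)

text \<open>Block i starts with a one at position \<open>p + sum_list (take i cs)\<close> after
  \<open>j + i\<close> earlier ones; its zeros begin one position later and after one more one.
  Hence the - 1 and the index \<open>Suc (j + i)\<close>.\<close>

lemma bit_weight_blocks:
  assumes "\<forall>c\<in>set cs. 1 \<le> c"
  shows "bit_weight a p j (blocks cs) = (\<Prod>i<length cs. of_nat (a ! Suc (j + i)) *
    falling (of_nat (xi a (Suc (j + i))) - 1 - of_nat (p + sum_list (take i cs))) (cs ! i - 1))"
  using assms
proof (induction cs arbitrary: p j)
  case (Cons c cs)
  have c: "Suc (p + (c - Suc 0)) = p + c" using Cons.prems by simp
  have "bit_weight a p j (blocks (c # cs)) = of_nat (a ! Suc j) *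
      (falling (of_nat (xi a (Suc j)) - of_nat (Suc p)) (c - 1) *
       bit_weight a (p + c) (Suc j) (blocks cs) :: 'a)"
    by (simp add: bit_weight_append bit_weight_replicate_False c del: of_nat_Suc)
  also have "bit_weight a (p + c) (Suc j) (blocks cs) =
      (\<Prod>i<length cs. of_nat (a ! Suc (Suc j + i)) *
        falling (of_nat (xi a (Suc (Suc j + i))) - 1 - of_nat (p + c + sum_list (take i cs)))
          (cs ! i - 1) :: 'a)"
    using Cons.prems by (intro Cons.IH) auto
  finally show ?case
    by (simp add: prod.lessThan_Suc_shift algebra_simps del: prod.lessThan_Suc)
qed simp

lemma of_int_gamma_coeff:
  assumes "composition n r b"
  shows "of_int (gamma_coeff r a b) = bit_weight a 0 0 (bits b)"
proof -
  obtain c cs where b: "b = c # cs" "length cs = r" "\<forall>d\<in>set cs. 1 \<le> d"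
    using assms by (rule compositionE)
  \<comment> \<open>The partial sum of b is the number of bits before block k; that of a combines
    with a_{k+1} to xi_{k+1}.\<close>
  have diff: "int (a ! Suc k) - 1 + (\<Sum>i=0..k. int (a ! i) - int (b ! i)) =
      int (xi a (Suc k)) - 1 - int (c + sum_list (take k cs))" if "k < r" for k
  proof -
    have "xi b k = c + sum_list (take k cs)"
      using that b by (subst xi_eq_sum_list) auto
    moreover have "(\<Sum>i=0..k. int (a ! i) - int (b ! i)) = int (xi a k) - int (xi b k)"
      by (simp add: sum_subtractf xi_def)
    ultimately show ?thesis by (simp add: xi_Suc)
  qed
  have "gamma_coeff r a b = falling (int (a ! 0)) (b ! 0) * (\<Prod>k<r. int (a ! Suc k) *
      falling (int (a ! Suc k) - 1 + (\<Sum>i=0..k. int (a ! i) - int (b ! i))) (b ! Suc k - 1))"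
    unfolding gamma_coeff_def One_nat_def
    by (simp add: prod.atLeast1_atMost_eq)
  also have "\<dots> = falling (int (a ! 0)) c * (\<Prod>k<r. int (a ! Suc k) *
      falling (int (xi a (Suc k)) - 1 - int (c + sum_list (take k cs))) (cs ! k - 1))"
    using diff by (intro arg_cong2[of _ _ _ _ "(*)"] prod.cong refl) (simp_all only: b lessThan_iff nth_Cons_0 nth_Cons_Suc)
  finally have "gamma_coeff r a b = \<dots>" .
  then show ?thesis
    using b by (simp add: bit_weight_append bit_weight_replicate_False bit_weight_blocks
        of_int_falling xi_def)
qed

text \<open>A zero read at position \<open>xi a j\<close> after j ones has weight 0, so the position
  cannot move past \<open>xi a j\<close> before another one is read, and each one raises this bound
  by at least 1.\<close>

lemma bit_weight_nonzero_imp_le_xi: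
  assumes "bit_weight a p j w \<noteq> (0 :: 'a::{comm_ring_1,ring_char_0})"
    and "p \<le> xi a j" and "\<forall>i\<in>{j<..j + ones w}. 1 \<le> a ! i"
  shows "p + length w \<le> xi a (j + ones w)"
  using assms
proof (induction w arbitrary: p j)
  case (Cons c w)
  show ?case
  proof (cases c)
    case True
    with Cons.prems have nz: "bit_weight a (Suc p) (Suc j) w \<noteq> (0 :: 'a)"
      by auto
    have "1 \<le> a ! Suc j" using Cons.prems True by auto
    then have "Suc p \<le> xi a (Suc j)" using Cons.prems by (simp add: xi_Suc)
    from Cons.IH[OF nz this] show ?thesis using Cons.prems True by auto
  next
    case False
    with Cons.prems have nz: "bit_weight a (Suc p) j w \<noteq> (0 :: 'a)" and "p \<noteq> xi a j"
      by auto
    then have "Suc p \<le> xi a j" using Cons.prems by simp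
    from Cons.IH[OF nz this] show ?thesis using Cons.prems False by auto
  qed
qed simp

lemma ones_take_bits_le:
  assumes a: "composition n r a" and "j \<le> r" "m \<le> xi a j"
  shows "ones (take m (bits a)) \<le> j"
proof -
  obtain c cs where cs: "a = c # cs" "length cs = r" "\<forall>d\<in>set cs. 1 \<le> d"
    using a by (rule compositionE)
  have len: "length (bits (c # take j cs)) = xi a j"
    using cs assms(2) length_blocks[of "take j cs"]
    by (subst xi_eq_sum_list) (auto dest: in_set_takeD)
  have "bits a = bits (c # take j cs) @ blocks (drop j cs)"
    unfolding cs by (simp flip: blocks_simps(3))
  then have "take (xi a j) (bits a) = bits (c # take j cs)"
    using len by (metis append_eq_conv_conj)
  then have "ones (take (xi a j) (bits a)) = j"
    using cs assms(2) by simp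
  then show ?thesis using ones_take_mono[OF assms(3), of "bits a"] by simp
qed

text \<open>After m bits with k ones, a nonzero weight forces m \<le> xi_k, and the first xi_k bits
  of \<open>bits a\<close> contain only k ones.\<close>

lemma bit_weight_nonzero_imp_dominates:
  assumes a: "composition n r a" and w: "w \<in> nr_sequences n r"
    and nz: "bit_weight a 0 0 w \<noteq> (0 :: 'a::{comm_ring_1,ring_char_0})"
  shows "w \<unrhd> bits a"
  unfolding dominates_def
proof (intro conjI allI impI)
  have "bits a \<in> nr_sequences n r" using a by (rule bits_in_nr_sequences)
  then show "length w = length (bits a)" using w by (simp add: nr_sequences_def)
  fix m assume "m \<le> length (bits a)"
  then have m: "m \<le> length w" using \<open>length w = length (bits a)\<close> by simp
  have split: "w = take m w @ drop m w" by simp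
  have "bit_weight a 0 0 (take m w) \<noteq> (0 :: 'a)"
    using nz by (subst (asm) split, subst (asm) bit_weight_append) auto
  moreover have le: "ones (take m w) \<le> r"
    using w ones_take_mono[OF m, of w] by (simp add: nr_sequences_def)
  ultimately have "m \<le> xi a (ones (take m w))"
    using bit_weight_nonzero_imp_le_xi[of a 0 0 "take m w"] a m by (auto simp: composition_def)
  with a le show "ones (take m (bits a)) \<le> ones (take m w)"
    by (rule ones_take_bits_le)
qed

section \<open>Linearity of \<open>Sp\<close>, and gamma-bar as a sum over all sequences\<close>

lemma const_xy_simps:
  "const_xy 0 = 0" "const_xy 1 = 1" "const_xy (c + d) = const_xy c + const_xy d"
  "const_xy (c - d) = const_xy c - const_xy d" "const_xy (c * d) = const_xy c * const_xy d"
  "const_xy (- c) = - const_xy c"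
  by (simp_all add: const_xy_def one_pCons)

lemma const_xy_sum: "const_xy (sum f A) = (\<Sum>x\<in>A. const_xy (f x))"
  by (induction A rule: infinite_finite_induct) (auto simp: const_xy_simps)

lemma const_xy_of_nat: "const_xy (of_nat m) = of_nat m"
  by (simp add: const_xy_def of_nat_poly)

lemma const_xy_minus_one_power: "const_xy ((- 1) ^ h * c) = (- 1) ^ h * const_xy c"
  by (induction h) (auto simp: const_xy_simps)

lemma Sp_sum: "Sp n r (sum f A) = (\<Sum>x\<in>A. Sp n r (f x))"
  by (induction A rule: infinite_finite_induct) (auto simp: Sp_add, auto simp: Sp_def)

text \<open>Sequences that do not dominate \<open>bits a\<close> have weight 0, so the sum extends
  to all sequences and can then be cut at any position.\<close>

lemma gamma_bar_eq_sum_nr_sequences: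
  assumes a: "composition n r a"
  shows "(gamma_bar n r a :: 'a::field_char_0 poly poly) =
    (\<Sum>w\<in>nr_sequences n r. const_xy (bit_weight a 0 0 w) * Sp_basis n r w)"
proof -
  let ?C = "{b. composition n r b}"
  let ?f = "\<lambda>w. const_xy (bit_weight a 0 0 w) * Sp_basis n r w :: 'a poly poly"
  have fin: "finite ?C" using bij_betw_finite[OF bij_betw_bits] by simp
  have "gamma_bar n r a = (\<Sum>b | composition n r b \<and> bits b \<unrhd> bits a. ?f (bits b))"
    unfolding gamma_bar_def gamma_elem_def Sp_sum
    by (intro sum.cong refl) (auto simp: Sp_single of_int_gamma_coeff)
  also have "\<dots> = (\<Sum>b\<in>?C. ?f (bits b))"
  proof (intro sum.mono_neutral_left[OF fin] ballI)
    fix b assume "b \<in> ?C - {b. composition n r b \<and> bits b \<unrhd> bits a}"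
    then have "bit_weight a 0 0 (bits b) = (0 :: 'a)"
      using bit_weight_nonzero_imp_dominates[OF a bits_in_nr_sequences] by blast
    then show "?f (bits b) = 0" by (simp add: const_xy_simps)
  qed auto
  also have "\<dots> = (\<Sum>w\<in>nr_sequences n r. ?f w)"
    by (rule sum.reindex_bij_betw[OF bij_betw_bits])
  finally show ?thesis .
qed

subsection \<open>Tau and the Tutte polynomial of a uniform matroid\<close>

text \<open>As functions of N, both sides satisfy s(N + 1) = (N choose d - 1) + y s(N) from N = d
  on, where both are 1; for N < d both are 0.\<close>

lemma tau_eq:
  assumes "d \<ge> 1"
  shows "(tau (int d) (int N - int d) :: 'a::field_char_0 poly poly) =
    (\<Sum>m=d..N. of_nat (N choose m) * (var_y - 1) ^ (m - d))"
proof -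
  obtain e where d: "d = Suc e" using assms by (cases d) auto
  let ?t = "\<lambda>N. \<Sum>m=d..N. of_nat (N choose m) * (var_y - 1) ^ (m - d) :: 'a poly poly"
  let ?u = "\<lambda>M. \<Sum>i\<le>M. of_nat (e + M - i choose e) * var_y ^ i :: 'a poly poly"
  have tau_u: "tau (int d) (int M) = ?u M" for M
  proof -
    have "(e + M - i choose (M - i)) = (e + M - i choose e)" if "i \<le> M" for i
      using that binomial_symmetric[of "M - i" "e + M - i"] by simp
    moreover have "nat (int M + int d - 1 - int i) = e + M - i" "nat (int M - int i) = M - i"
      if "i \<le> M" for i using that d by auto
    ultimately show ?thesis
      using d by (simp add: tau_def atLeast0AtMost)
  qed
  have u_Suc: "?u (Suc M) = of_nat (e + Suc M choose e) + var_y * ?u M" for M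
    by (simp add: sum.atMost_Suc_shift sum_distrib_left mult_ac del: sum.atMost_Suc)
  have t_Suc: "?t (Suc N) = of_nat (N choose e) + var_y * ?t N" if "d \<le> Suc N" for N
  proof -
    \<comment> \<open>Pascal's rule. The second sum is s(N); the first, reindexed, is its lowest
      term (N choose e) plus (y - 1) s(N), so that s(N) gets the total factor y.\<close>
    have "?t (Suc N) = (\<Sum>m=d..Suc N. of_nat (N choose (m - 1)) * (var_y - 1) ^ (m - d)) +
        (\<Sum>m=d..Suc N. of_nat (N choose m) * (var_y - 1) ^ (m - d))"
      unfolding sum.distrib[symmetric]
    proof (intro sum.cong refl)
      fix m assume "m \<in> {d..Suc N}"
      then obtain l where "m = Suc l" using d by (cases m) auto
      then show "of_nat (Suc N choose m) * (var_y - 1) ^ (m - d) =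
          of_nat (N choose (m - 1)) * (var_y - 1) ^ (m - d) +
          (of_nat (N choose m) * (var_y - 1) ^ (m - d) :: 'a poly poly)"
        by (simp add: algebra_simps)
    qed
    also have "(\<Sum>m=d..Suc N. of_nat (N choose m) * (var_y - 1) ^ (m - d)) = ?t N"
      using that by (simp add: binomial_eq_0)
    also have "(\<Sum>m=d..Suc N. of_nat (N choose (m - 1)) * (var_y - 1) ^ (m - d)) =
        (\<Sum>m=e..N. of_nat (N choose m) * (var_y - 1) ^ (m - e) :: 'a poly poly)"
      unfolding d sum.shift_bounds_cl_Suc_ivl by simp
    also have "\<dots> = of_nat (N choose e) + (\<Sum>m=d..N. of_nat (N choose m) * (var_y - 1) ^ (m - e))"
      using that d by (simp add: sum.atLeast_Suc_atMost)
    also have "(\<Sum>m=d..N. of_nat (N choose m) * (var_y - 1) ^ (m - e)) = (var_y - 1) * ?t N"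
      unfolding sum_distrib_left
    proof (intro sum.cong refl)
      fix m assume "m \<in> {d..N}"
      then have "m - e = Suc (m - d)" using d by auto
      then show "of_nat (N choose m) * (var_y - 1) ^ (m - e) =
          (var_y - 1) * (of_nat (N choose m) * (var_y - 1) ^ (m - d) :: 'a poly poly)"
        by (simp add: mult_ac)
    qed
    finally show ?thesis by (simp add: algebra_simps)
  qed
  have t_u: "?t (d + M) = ?u M" for M
  proof (induction M)
    case (Suc M)
    show ?case using t_Suc[of "d + M"] u_Suc[of M] Suc d by (simp del: sum.cl_ivl_Suc sum.atMost_Suc)
  qed simp
  show ?thesis
  proof (cases "d \<le> N")
    case True
    then show ?thesis using tau_u[of "N - d"] t_u[of "N - d"] by (simp add: of_nat_diff)
  next
    case False
    then show ?thesis by (simp add: tau_def)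
  qed
qed

lemma rank_of_uniform:
  assumes "A \<subseteq> {..<n}"
  shows "rank_of (uniform_indep r n) A = min (card A) r"
  unfolding rank_of_def
proof (rule Max_eqI)
  have fin: "finite A" using assms finite_subset by blast
  show "finite {card B |B. B \<subseteq> A \<and> uniform_indep r n B}"
    using fin by (auto intro!: finite_subset[of _ "card ` Pow A"])
  show "k \<le> min (card A) r" if "k \<in> {card B |B. B \<subseteq> A \<and> uniform_indep r n B}" for k
    using that fin by (auto simp: uniform_indep_def intro: card_mono)
  obtain B where "B \<subseteq> A" "card B = min (card A) r"
    using obtain_subset_with_card_n[of "min (card A) r" A] by auto
  then show "min (card A) r \<in> {card B |B. B \<subseteq> A \<and> uniform_indep r n B}"
    using assms by (auto simp: uniform_indep_def intro!: exI[of _ B])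
qed

text \<open>The rank depends on the cardinality only, so the subsets can be grouped by it.\<close>

lemma tutte_uniform_eq:
  assumes "r \<le> n"
  shows "(tutte_uniform r n :: 'a::field_char_0 poly poly) =
    (\<Sum>m\<le>n. of_nat (n choose m) * ((var_x - 1) ^ (r - min m r) * (var_y - 1) ^ (m - min m r)))"
proof -
  let ?f = "\<lambda>m. (var_x - 1) ^ (r - min m r) * (var_y - 1) ^ (m - min m r) :: 'a poly poly"
  have "tutte_uniform r n = (\<Sum>A\<in>Pow {..<n}. ?f (card A))"
    unfolding tutte_uniform_def tutte_def
    by (intro sum.cong refl) (simp add: rank_of_uniform assms min_absorb2)
  also have "\<dots> = (\<Sum>m\<le>n. \<Sum>A\<in>{A \<in> Pow {..<n}. card A = m}. ?f (card A))"
    by (rule sum.group[symmetric]) (auto dest: subset_eq_atLeast0_lessThan_card intro: card_mono[of "{..<n}", simplified])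
  also have "\<dots> = (\<Sum>m\<le>n. of_nat (n choose m) * ?f m)"
  proof (intro sum.cong refl)
    fix m
    have "(\<Sum>A\<in>{A \<in> Pow {..<n}. card A = m}. ?f (card A)) =
        (\<Sum>A\<in>{A \<in> Pow {..<n}. card A = m}. ?f m)"
      by (intro sum.cong) auto
    also have "\<dots> = of_nat (n choose m) * ?f m"
      using n_subsets[of "{..<n}" m] by simp
    finally show "(\<Sum>A\<in>{A \<in> Pow {..<n}. card A = m}. ?f (card A)) = of_nat (n choose m) * ?f m" .
  qed
  finally show ?thesis .
qed

subsection \<open>Compositions without loops\<close>

lemma nu_Nil [simp]: "nu [] = 1"
  by (simp add: nu_def)

lemma nu_Cons:
  assumes "cs \<noteq> []"
  shows "nu (c # cs) = of_nat (c + sum_list cs) / of_nat c * nu cs"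
proof -
  obtain k where "length cs = Suc k"
    using assms by (cases cs) auto
  then show ?thesis
    by (simp add: nu_def prod.lessThan_Suc_shift del: prod.lessThan_Suc)
qed

lemma nu_singleton [simp]: "nu [c] = 1"
  by (simp add: nu_def)

lemma xi_add_sum_list:
  assumes "p \<le> q" "q < length a"
  shows "xi a p + sum_list (take (q - p) (drop (Suc p) a)) = xi a q"
proof -
  have "take (Suc q) a = take (Suc p) a @ take (q - p) (drop (Suc p) a)"
    using assms by (simp flip: take_add)
  then show ?thesis
    using assms by (simp add: xi_eq_sum_list)
qed

text \<open>For nonempty c the product has one factor more than \<open>nu\<close>: the last one,
  which is c_s / c_s = 1.\<close>

lemma inverse_nu:
  assumes "\<forall>d\<in>set c. 1 \<le> d"
  shows "1 / nu c = (\<Prod>i<length c. of_nat (c ! i) / of_nat (sum_list (drop i c)) :: 'a::field_char_0)"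
  using assms
proof (induction c)
  case (Cons d c)
  have nz: "of_nat d \<noteq> (0 :: 'a)" using Cons.prems by auto
  have "1 / nu (d # c) = of_nat d / of_nat (d + sum_list c) * (1 / nu c :: 'a)"
    using nz by (cases "c = []") (simp_all add: nu_Cons)
  also have "1 / nu c = (\<Prod>i<length c. of_nat (c ! i) / of_nat (sum_list (drop i c)) :: 'a)"
    using Cons by simp
  finally show ?case
    by (simp add: prod.lessThan_Suc_shift del: prod.lessThan_Suc)
qed simp

text \<open>The abbreviations enter as parameters with defining equations, so they unfold only on
  request. \<open>A\<close> gives the interpolation nodes, \<open>v\<close> the factors of the
  suffix sums.\<close>

locale loopless_composition =
  fixes a :: "nat list" and n r :: nat and A \<alpha> v P :: "nat \<Rightarrow> 'a::field_char_0"
  assumes comp: "composition n r a" and loopless: "a ! 0 = 0" and r_pos: "1 \<le> r"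
    and A_def: "A = (\<lambda>i. of_nat (xi a i))"
    and \<alpha>_def: "\<alpha> = (\<lambda>i. of_nat (a ! i))"
    and v_def: "v = (\<lambda>k. 1 / nu (drop k (tl a)))"
    and P_def: "P = (\<lambda>k. \<Prod>i=1..k. \<alpha> i)"
begin

section \<open>Nodes, and the prefix and suffix sums\<close>

lemma len: "length a = Suc r"
  using comp by (simp add: composition_def)

lemma part_pos: "1 \<le> i \<Longrightarrow> i \<le> r \<Longrightarrow> 1 \<le> a ! i"
  using comp by (simp add: composition_def)

lemma xi_0 [simp]: "xi a 0 = 0"
  using loopless by (simp add: xi_def)

lemma xi_r [simp]: "xi a r = n"
  using comp len by (simp add: xi_eq_sum_list composition_def)

lemma xi_less: "i < j \<Longrightarrow> j \<le> r \<Longrightarrow> xi a i < xi a j"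
proof (induction j)
  case (Suc j)
  have "xi a j < xi a (Suc j)" using part_pos[of "Suc j"] Suc.prems by (simp add: xi_Suc)
  then show ?case using Suc by (cases "i = j") auto
qed simp

lemma xi_mono: "i \<le> j \<Longrightarrow> j \<le> r \<Longrightarrow> xi a i \<le> xi a j"
  using xi_less[of i j] by (cases "i = j") auto

lemma le_xi: "i \<le> r \<Longrightarrow> i \<le> xi a i"
proof (induction i)
  case (Suc i)
  then show ?case using xi_less[of i "Suc i"] by simp
qed simp

lemma r_le_n: "r \<le> n"
  using le_xi[of r] by simp

lemma A_0 [simp]: "A 0 = 0"
  by (simp add: A_def)

lemma A_r: "A r = of_nat n"
  by (simp add: A_def)

lemma A_eq_iff: "i \<le> r \<Longrightarrow> j \<le> r \<Longrightarrow> A i = A j \<longleftrightarrow> i = j"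
  using xi_less[of i j] xi_less[of j i] by (auto simp: A_def) (metis linorder_neqE_nat less_irrefl)

lemma inj_on_A: "k \<le> r \<Longrightarrow> inj_on A {..k}"
  by (auto simp: inj_on_def A_eq_iff)

lemma A_gbinomial: "A l gchoose m = of_nat (xi a l choose m)"
  by (simp add: A_def binomial_gbinomial)

lemma P_0 [simp]: "P 0 = 1"
  by (simp add: P_def)

lemma P_Suc: "P (Suc k) = P k * \<alpha> (Suc k)"
  by (simp add: P_def)

lemma v_r: "v r = 1"
  using len by (simp add: v_def)

text \<open>Prepending a_{k+1} multiplies \<open>nu\<close> by (a_{k+1} + ... + a_r) / a_{k+1}, and
  the sum in the numerator is A_r - A_k.\<close>

lemma v_rec:
  assumes "k < r"
  shows "v k * (A r - A k) = \<alpha> (Suc k) * v (Suc k)"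
proof -
  let ?cs = "drop (Suc k) (tl a)"
  have "drop k (tl a) = tl a ! k # ?cs"
    using assms len by (intro Cons_nth_drop_Suc[symmetric]) simp
  then have dr: "drop k (tl a) = a ! Suc k # ?cs"
    using assms len by (simp add: nth_tl)
  have "xi a k + sum_list (drop k (tl a)) = xi a r"
    using xi_add_sum_list[of k r a] assms len by (simp add: drop_Suc)
  then have sum: "xi a k + (a ! Suc k + sum_list ?cs) = xi a r"
    unfolding dr by simp
  then have diff: "A r - A k = of_nat (a ! Suc k + sum_list ?cs)"
    unfolding A_def by (metis add_diff_cancel_left' of_nat_add)
  have nz: "of_nat (a ! Suc k + sum_list ?cs) \<noteq> (0 :: 'a)" "of_nat (a ! Suc k) \<noteq> (0 :: 'a)"
    using part_pos[of "Suc k"] assms by (simp_all flip: of_nat_add)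
  show ?thesis
  proof (cases "?cs = []")
    case True
    then show ?thesis unfolding diff unfolding v_def dr \<alpha>_def by simp
  next
    case False
    show ?thesis unfolding diff unfolding v_def dr \<alpha>_def nu_Cons[OF False] using nz by simp
  qed
qed

text \<open>Split off the last bit: a zero contributes A_j - m, a one contributes a_j and leads back
  to j - 1. Up to the factor m! P_j this is the recurrence \<open>divdiff_gbinomial_Suc\<close> at t
  = A_j.\<close>

lemma sum_prefix_weights:
  assumes "j \<le> r"
  shows "(\<Sum>w\<in>nr_sequences m j. bit_weight a 0 0 w) =
    fact m * P j * divdiff (A ` {..j}) (\<lambda>x. x gchoose m)"
  using assms
proof (induction m arbitrary: j)
  case 0
  \<comment> \<open>The empty sequence has no ones, and the constant 1 has divided difference 0 at
    two or more nodes.\<close>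
  have "divdiff (A ` {..j}) (\<lambda>_. 1) = (0 :: 'a)" if "j \<noteq> 0"
    using that 0 card_image[OF inj_on_A[of j]] by (intro divdiff_one_eq_0) auto
  then show ?case by (auto simp: nr_sequences_0 divdiff_def)
next
  case (Suc m)
  let ?D = "\<lambda>S m. divdiff S (\<lambda>x :: 'a. x gchoose m)"
  let ?W = "\<lambda>m j. \<Sum>w\<in>nr_sequences m j. bit_weight a 0 0 w :: 'a"
  have False_part: "(\<Sum>w\<in>nr_sequences m j. bit_weight a 0 0 (w @ [False])) =
      ?W m j * (A j - of_nat m)"
    by (simp add: sum_distrib_right bit_weight_append A_def nr_sequences_def)
  have True_part: "(if j = 0 then 0 else \<Sum>w\<in>nr_sequences m (j - 1). bit_weight a 0 0 (w @ [True])) =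
      fact m * P j * ?D (A ` {..<j}) m"
  proof (cases j)
    case 0
    then show ?thesis by (simp add: divdiff_def)
  next
    case (Suc i)
    have "(\<Sum>w\<in>nr_sequences m i. bit_weight a 0 0 (w @ [True])) = ?W m i * \<alpha> j"
      by (simp add: sum_distrib_right bit_weight_append \<alpha>_def nr_sequences_def Suc)
    then show ?thesis
      using Suc.IH[of i] Suc.prems Suc by (simp add: P_Suc lessThan_Suc_atMost)
  qed
  have "A ` {..j} - {A j} = A ` {..<j}"
    using Suc.prems by (auto simp: A_eq_iff less_le)
  then have "of_nat (Suc m) * ?D (A ` {..j}) (Suc m) =
      ?D (A ` {..<j}) m + (A j - of_nat m) * ?D (A ` {..j}) m"
    using divdiff_gbinomial_Suc[of "A ` {..j}" "A j" m] by simp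
  then have "fact (Suc m) * P j * ?D (A ` {..j}) (Suc m) =
      fact m * P j * (?D (A ` {..<j}) m + (A j - of_nat m) * ?D (A ` {..j}) m)"
    by (simp only: fact_Suc mult_ac)
  then show ?case
    unfolding sum_nr_sequences_snoc False_part True_part Suc.IH[OF Suc.prems]
    by (simp add: algebra_simps)
qed

text \<open>Split off the first bit and use \<open>v_rec\<close>: the two branches add up to q! v_j
  ((A_j - m) + (A_r - A_j)) = q! v_j (n - m), and n - m = q + 1.\<close>

lemma sum_suffix_weights:
  assumes "j \<le> r" "m \<le> xi a j" "m + q = n"
  shows "(\<Sum>w\<in>nr_sequences q (r - j). bit_weight a m j w) = fact q * v j"
  using assms
proof (induction q arbitrary: m j)
  case 0
  \<comment> \<open>Here m = n, and n \<le> xi_j only for j = r.\<close>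
  then have "j = r" using xi_less[of j r] by force
  then show ?case by (simp add: nr_sequences_0 v_r)
next
  case (Suc q)
  let ?V = "\<lambda>m j. \<Sum>w\<in>nr_sequences q (r - j). bit_weight a m j w :: 'a"
  have n: "of_nat n = of_nat m + (of_nat (Suc q) :: 'a)"
    using Suc.prems(3) by (metis of_nat_add)
  have "(\<Sum>w\<in>nr_sequences (Suc q) (r - j). bit_weight a m j w) =
      (A j - of_nat m) * ?V (Suc m) j + (if j = r then 0 else \<alpha> (Suc j) * ?V (Suc m) (Suc j))"
    using Suc.prems by (auto simp: sum_nr_sequences_Cons sum_distrib_left A_def \<alpha>_def)
  \<comment> \<open>If m = xi_j, the induction hypothesis does not apply at m + 1, but then the
    factor A_j - m is 0.\<close>
  also have "(A j - of_nat m) * ?V (Suc m) j = (A j - of_nat m) * (fact q * v j)"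
    using Suc.IH[of j "Suc m"] Suc.prems by (cases "m = xi a j") (auto simp: A_def)
  also have "(if j = r then 0 else \<alpha> (Suc j) * ?V (Suc m) (Suc j)) =
      (if j = r then 0 else fact q * (\<alpha> (Suc j) * v (Suc j)))"
    using Suc.IH[of "Suc j" "Suc m"] Suc.prems xi_less[of j "Suc j"] by auto
  \<comment> \<open>For j = r the missing branch agrees with A_r - A_j = 0.\<close>
  also have "\<dots> = fact q * (v j * (A r - A j))"
    using v_rec[of j] Suc.prems by (auto simp: le_less)
  also have "(A j - of_nat m) * (fact q * v j) + fact q * (v j * (A r - A j)) =
      fact q * v j * (A r - of_nat m)"
    by (simp add: algebra_simps)
  also have "\<dots> = fact (Suc q) * v j"
    by (simp add: A_r n del: of_nat_Suc)
  finally show ?case .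
qed

section \<open>The coefficients of gamma-bar in powers of x - 1 and y - 1\<close>

definition xy_coeff :: "nat \<Rightarrow> nat \<Rightarrow> 'a" where
  "xy_coeff j m = v j * P j * divdiff (A ` {..j}) (\<lambda>x. x gchoose m)"

text \<open>The factorials m! and (n - m)! of the two sums cancel (n choose m) / n!.\<close>

lemma binomial_times_weights:
  assumes "m \<le> n" "j \<le> r"
  shows "of_nat (n choose m) / fact n * ((\<Sum>u\<in>nr_sequences m j. bit_weight a 0 0 u) *
    (\<Sum>w\<in>nr_sequences (n - m) (r - j). bit_weight a m j w)) = xy_coeff j m"
proof (cases "m \<le> xi a j")
  case True
  show ?thesis
    using assms
    unfolding sum_prefix_weights[OF assms(2)] sum_suffix_weights[OF assms(2) True le_add_diff_inverse[OF assms(1)]]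
    by (simp add: xy_coeff_def binomial_fact)
next
  case False
  have "divdiff (A ` {..j}) (\<lambda>x. x gchoose m) = 0"
    unfolding divdiff_def
  proof (rule sum.neutral, safe)
    fix l assume "l \<le> j"
    then have "xi a l < m" using xi_mono[of l j] False assms by simp
    then show "(A l gchoose m) * (\<Prod>z\<in>A ` {..j} - {A l}. inverse (A l - z)) = 0"
      by (simp add: A_gbinomial)
  qed
  then show ?thesis
    by (simp add: xy_coeff_def sum_prefix_weights[OF assms(2)])
qed

lemma gamma_bar_eq:
  "gamma_bar n r a = (\<Sum>m\<le>n. \<Sum>j\<le>min m r.
     const_xy (xy_coeff j m) * ((var_x - 1) ^ (r - j) * (var_y - 1) ^ (m - j)))"
proof -
  let ?X = "var_x - 1 :: 'a poly poly" and ?Y = "var_y - 1 :: 'a poly poly"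
  \<comment> \<open>The sequence enters only through its two pieces, as cutting requires;
    \<open>ones u\<close> becomes j afterwards.\<close>
  let ?G = "\<lambda>m u w. const_xy (bit_weight a 0 0 u * bit_weight a m (ones u) w) *
    (?X ^ (r - ones u) * ?Y ^ (m - ones u))"
  have "gamma_bar n r a = (\<Sum>w\<in>nr_sequences n r. \<Sum>m\<le>n.
      const_xy (of_nat (n choose m) / fact n) * (const_xy (bit_weight a 0 0 w) *
        (?X ^ (r - ones (take m w)) * ?Y ^ (m - ones (take m w)))))"
    unfolding gamma_bar_eq_sum_nr_sequences[OF comp] Sp_basis_def sum_distrib_left atLeast0AtMost
    by (intro sum.cong refl)
      (simp add: divide_inverse const_xy_simps const_xy_of_nat algebra_simps)
  also have "\<dots> = (\<Sum>m\<le>n. const_xy (of_nat (n choose m) / fact n) *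
      (\<Sum>w\<in>nr_sequences n r. const_xy (bit_weight a 0 0 w) *
        (?X ^ (r - ones (take m w)) * ?Y ^ (m - ones (take m w)))))"
    by (subst sum.swap) (simp add: sum_distrib_left)
  also have "\<dots> = (\<Sum>m\<le>n. \<Sum>j\<le>min m r. const_xy (xy_coeff j m) * (?X ^ (r - j) * ?Y ^ (m - j)))"
  proof (intro sum.cong refl)
    fix m assume "m \<in> {..n}"
    then have m: "m \<le> n" by simp
    have "(\<Sum>w\<in>nr_sequences n r. const_xy (bit_weight a 0 0 w) *
        (?X ^ (r - ones (take m w)) * ?Y ^ (m - ones (take m w)))) =
        (\<Sum>w\<in>nr_sequences n r. ?G m (take m w) (drop m w))"
    proof (intro sum.cong refl)
      fix w assume "w \<in> nr_sequences n r"
      then have "bit_weight a 0 0 w =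
          (bit_weight a 0 0 (take m w) * bit_weight a m (ones (take m w)) (drop m w) :: 'a)"
        using m bit_weight_append[of a 0 0 "take m w" "drop m w"]
        by (simp add: nr_sequences_def min_absorb2)
      then show "const_xy (bit_weight a 0 0 w) *
          (?X ^ (r - ones (take m w)) * ?Y ^ (m - ones (take m w))) = ?G m (take m w) (drop m w)"
        by simp
    qed
    also have "\<dots> = (\<Sum>j\<le>min m r. \<Sum>u\<in>nr_sequences m j. \<Sum>w\<in>nr_sequences (n - m) (r - j). ?G m u w)"
      by (rule sum_nr_sequences_split[OF m])
    also have "\<dots> = (\<Sum>j\<le>min m r. const_xy ((\<Sum>u\<in>nr_sequences m j. bit_weight a 0 0 u) *
        (\<Sum>w\<in>nr_sequences (n - m) (r - j). bit_weight a m j w)) * (?X ^ (r - j) * ?Y ^ (m - j)))"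
      unfolding sum_product unfolding const_xy_sum sum_distrib_right
      by (intro sum.cong refl) (auto simp: nr_sequences_def)
    finally have split: "(\<Sum>w\<in>nr_sequences n r. const_xy (bit_weight a 0 0 w) *
        (?X ^ (r - ones (take m w)) * ?Y ^ (m - ones (take m w)))) = \<dots>" .
    show "const_xy (of_nat (n choose m) / fact n) *
        (\<Sum>w\<in>nr_sequences n r. const_xy (bit_weight a 0 0 w) *
          (?X ^ (r - ones (take m w)) * ?Y ^ (m - ones (take m w)))) =
        (\<Sum>j\<le>min m r. const_xy (xy_coeff j m) * (?X ^ (r - j) * ?Y ^ (m - j)))"
      unfolding split using m
      by (subst sum_distrib_left, intro sum.cong refl)
        (simp only: atMost_iff min.bounded_iff binomial_times_weights[symmetric] const_xy_simps mult.assoc)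
  qed
  finally show ?thesis .
qed


section \<open>Divided differences with the additional node A_r\<close>

abbreviation nodes :: "nat \<Rightarrow> 'a set" where
  "nodes k \<equiv> insert (A r) (A ` {..k})"

text \<open>Chosen so that, for k < r, the term at A_r of the divided difference at
  \<open>nodes k\<close>, scaled by \<open>node_factor k\<close>, is f_r (n choose m).\<close>

definition node_factor :: "nat \<Rightarrow> 'a" where
  "node_factor k = v k * (A r - A k) * P k"

text \<open>For k < r, minus the scaled divided difference with its term at A_r taken out. For 1
  \<le> k < m these are the coefficients of (y - 1)^(m-k-1) in the inner sum of the theorem.\<close>

definition tail_coeff :: "nat \<Rightarrow> nat \<Rightarrow> 'a" where
  "tail_coeff k m = f_coeff a r * of_nat (n choose m) - node_factor k * divdiff (nodes k) (\<lambda>x. x gchoose m)"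

lemma f_coeff_r: "f_coeff a r = v 0"
  using len by (simp add: f_coeff_def v_def)

lemma A_r_notin: "k < r \<Longrightarrow> A r \<notin> A ` {..k}"
  by (auto simp: A_eq_iff)

lemma node_factor_eq: "k < r \<Longrightarrow> node_factor k = v (Suc k) * P (Suc k)"
  by (simp add: node_factor_def v_rec P_Suc)

text \<open>A polynomial of degree k has vanishing divided difference at the k + 2 nodes.\<close>

lemma tail_coeff_diagonal: "k < r \<Longrightarrow> tail_coeff k k = f_coeff a r * of_nat (n choose k)"
  using A_r_notin[of k] card_image[OF inj_on_A[of k]]
  by (simp add: tail_coeff_def divdiff_gbinomial_eq_0)

lemma xy_coeff_0: "xy_coeff 0 m = (if m = 0 then f_coeff a r else 0)"
  by (simp add: xy_coeff_def divdiff_def gbinomial_0_left f_coeff_r)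

text \<open>The node recurrence at \<open>nodes j\<close>: dropping A_j leaves
  \<open>nodes (j - 1)\<close>, dropping A_r leaves the nodes of \<open>xy_coeff j\<close>. The
  factor A_r - A_j is absorbed by \<open>node_factor\<close>, and the terms with f_r cancel.\<close>

lemma xy_coeff_eq:
  assumes "1 \<le> j" "j < r"
  shows "xy_coeff j m = tail_coeff j m - tail_coeff (j - 1) m"
proof -
  obtain i where i: "j = Suc i" using assms by (cases j) auto
  let ?D = "\<lambda>S. divdiff S (\<lambda>x :: 'a. x gchoose m)"
  have "nodes j - {A j} = nodes i"
    using assms i by (auto simp: A_eq_iff atMost_Suc)
  moreover have "nodes j - {A r} = A ` {..j}"
    using A_r_notin[of j] assms by auto
  ultimately have D: "(A r - A j) * ?D (nodes j) = ?D (nodes i) - ?D (A ` {..j})"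
    using divdiff_node_difference[of "nodes j" "A r" "A j"] by simp
  have e_i: "node_factor i = v j * P j" using assms i by (simp add: node_factor_eq)
  have "xy_coeff j m = v j * P j * (?D (nodes i) - (A r - A j) * ?D (nodes j))"
    unfolding D by (simp add: xy_coeff_def)
  also have "\<dots> = node_factor i * ?D (nodes i) - node_factor j * ?D (nodes j)"
    unfolding e_i node_factor_def[of j] by (simp add: algebra_simps)
  finally show ?thesis by (simp add: tail_coeff_def i)
qed

text \<open>\<open>nodes (r - 1)\<close> is already the full set of nodes, so only one tail
  coefficient occurs and its term with f_r has to be compensated.\<close>

lemma xy_coeff_r: "xy_coeff r m = f_coeff a r * of_nat (n choose m) - tail_coeff (r - 1) m"
proof -
  have "nodes (r - 1) = A ` {..r}"
    using r_pos by (cases r) (auto simp: atMost_Suc)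
  moreover have "node_factor (r - 1) = v r * P r"
    using node_factor_eq[of "r - 1"] r_pos by simp
  ultimately show ?thesis by (simp add: tail_coeff_def xy_coeff_def)
qed

lemma v_0_eq:
  assumes "k \<le> r"
  shows "v 0 = v k * P k * (\<Prod>i<k. inverse (A r - A i))"
  using assms
proof (induction k)
  case (Suc k)
  have "A r - A k \<noteq> 0" using Suc.prems by (simp add: A_eq_iff)
  then have "v k = \<alpha> (Suc k) * v (Suc k) * inverse (A r - A k)"
    using v_rec[of k] Suc.prems by (simp add: field_simps)
  then show ?case using Suc by (simp add: P_Suc mult_ac)
qed simp

text \<open>The term at A_r cancels the term with f_r, and the term at A_0 = 0 vanishes because m
  \<ge> 1.\<close>

lemma tail_coeff_eq_sum:
  assumes "k < r" "1 \<le> m"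
  shows "tail_coeff k m =
    (\<Sum>l=1..k. - node_factor k * (\<Prod>z\<in>nodes k - {A l}. inverse (A l - z)) * of_nat (xi a l choose m))"
proof -
  let ?g = "\<lambda>x. (x gchoose m) * (\<Prod>z\<in>nodes k - {x}. inverse (x - z))"
  have "nodes k - {A r} = A ` {..k}" using A_r_notin[of k] assms by auto
  then have "?g (A r) = of_nat (n choose m) * (\<Prod>i\<le>k. inverse (A r - A i))"
    using assms inj_on_A[of k] by (simp add: A_gbinomial prod.reindex)
  moreover have "node_factor k * (\<Prod>i\<le>k. inverse (A r - A i)) = v 0"
  proof -
    \<comment> \<open>\<open>v_0_eq\<close> covers i < k; the factor for i = k cancels A_r - A_k in
      \<open>node_factor k\<close>.\<close>
    have "A r - A k \<noteq> 0" using assms by (simp add: A_eq_iff)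
    then show ?thesis
      using v_0_eq[of k] assms by (simp add: node_factor_def lessThan_Suc_atMost[symmetric])
  qed
  ultimately have "node_factor k * ?g (A r) = f_coeff a r * of_nat (n choose m)"
    by (simp add: f_coeff_r mult_ac)
  moreover have "divdiff (nodes k) (\<lambda>x. x gchoose m) = ?g (A r) + (\<Sum>l\<le>k. ?g (A l))"
    unfolding divdiff_def using A_r_notin[of k] assms inj_on_A[of k] by (simp add: sum.reindex)
  ultimately have "tail_coeff k m = - node_factor k * (\<Sum>l\<le>k. ?g (A l))"
    by (simp add: tail_coeff_def distrib_left)
  also have "(\<Sum>l\<le>k. ?g (A l)) = (\<Sum>l=1..k. ?g (A l))"
  proof (rule sum.mono_neutral_right)
    show "\<forall>l\<in>{..k} - {1..k}. ?g (A l) = 0"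
      using assms by (auto simp: gbinomial_0_left not_less_eq_eq)
  qed auto
  also have "- node_factor k * \<dots> =
      (\<Sum>l=1..k. - node_factor k * (\<Prod>z\<in>nodes k - {A l}. inverse (A l - z)) * of_nat (xi a l choose m))"
    unfolding sum_distrib_left by (simp add: A_gbinomial mult_ac)
  finally show ?thesis .
qed

lemma tail_coeff_0: "1 \<le> m \<Longrightarrow> tail_coeff 0 m = 0"
  using tail_coeff_eq_sum[of 0 m] r_pos by simp

section \<open>The signed \<open>f_quot\<close> as Lagrange weights\<close>

lemma seg_eq:
  assumes "i < j"
  shows "of_nat (seg a j (Suc i)) = A j - A i"
proof -
  have "xi a i + (\<Sum>l=Suc i..k. a ! l) = xi a k" if "i \<le> k" for k
    using that by (induction k rule: dec_induct) (auto simp: xi_Suc)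
  then have "xi a i + seg a j (Suc i) = xi a j"
    using assms by (simp add: seg_def)
  then have "A j = A i + of_nat (seg a j (Suc i))"
    unfolding A_def by (metis of_nat_add)
  then show ?thesis by simp
qed

text \<open>The sums in \<open>nu\<close> of the first l parts are the differences A_l - A_i, which
  supplies the nodes to the left of A_l.\<close>

lemma f_coeff_eq:
  assumes "1 \<le> l" "l \<le> r"
  shows "f_coeff a l = P l * (\<Prod>i<l. inverse (A l - A i)) * v l"
proof -
  let ?c = "take l (tl a)"
  have len_c: "length ?c = l" using assms len by simp
  have "\<forall>d\<in>set ?c. 1 \<le> d"
  proof
    fix d assume "d \<in> set ?c"
    then obtain i where "i < l" "d = a ! Suc i"
      using assms len by (auto simp: in_set_conv_nth nth_tl)
    then show "1 \<le> d" using part_pos[of "Suc i"] assms by simp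
  qed
  then have "1 / nu ?c = (\<Prod>i<l. of_nat (?c ! i) / of_nat (sum_list (drop i ?c)) :: 'a)"
    using inverse_nu[of ?c, where 'a = 'a] unfolding len_c by blast
  also have "\<dots> = (\<Prod>i<l. \<alpha> (Suc i) * inverse (A l - A i))"
  proof (intro prod.cong refl)
    fix i assume "i \<in> {..<l}"
    then have i: "i < l" by simp
    have "drop i ?c = take (l - i) (drop (Suc i) a)"
      by (simp add: drop_take drop_Suc drop_tl)
    then have "xi a i + sum_list (drop i ?c) = xi a l"
      using xi_add_sum_list[of i l a] i assms len by simp
    then have "A l = A i + of_nat (sum_list (drop i ?c))"
      unfolding A_def by (metis of_nat_add)
    moreover have "?c ! i = a ! Suc i"
      using i assms len by (simp add: nth_tl)
    ultimately show "of_nat (?c ! i) / of_nat (sum_list (drop i ?c)) =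
        \<alpha> (Suc i) * inverse (A l - A i)"
      by (simp add: \<alpha>_def divide_inverse)
  qed
  also have "\<dots> = P l * (\<Prod>i<l. inverse (A l - A i))"
    by (simp add: prod.distrib P_def prod.atLeast1_atMost_eq)
  finally have nu_c: "1 / nu ?c = P l * (\<Prod>i<l. inverse (A l - A i))" .
  have "f_coeff a l = 1 / nu ?c * v l"
    by (simp add: f_coeff_def v_def)
  then show ?thesis unfolding nu_c .
qed

text \<open>Supplies the nodes to the right of A_l through the denominators A_j - A_l. The numerator
  indices are shifted by one, as a_{r:j+1} = A_r - A_j.\<close>

lemma m_quot_eq:
  assumes "l \<le> k" "k < r"
  shows "m_quot a k l = (\<Prod>j=Suc l..k. (A r - A j) * inverse (A j - A l))"
proof -
  have "(\<Prod>j=l+2..k+1. of_nat (seg a r j)) = (\<Prod>j=Suc l..k. of_nat (seg a r (Suc j)) :: 'a)"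
    using prod.shift_bounds_cl_Suc_ivl[of "\<lambda>j. of_nat (seg a r j) :: 'a" "Suc l" k]
    by (simp del: prod.cl_ivl_Suc)
  also have "\<dots> = (\<Prod>j=Suc l..k. A r - A j)"
    using assms by (intro prod.cong refl) (simp add: seg_eq)
  finally have "(\<Prod>j=l+2..k+1. of_nat (seg a r j)) = (\<Prod>j=Suc l..k. A r - A j)" .
  moreover have "(\<Prod>j=l+1..k. of_nat (seg a j (l + 1))) = (\<Prod>j=Suc l..k. A j - A l)"
    using assms by (intro prod.cong) (auto simp: seg_eq)
  ultimately show ?thesis
    by (simp add: m_quot_def len divide_inverse prod.distrib prod_inversef[symmetric] o_def)
qed

text \<open>From k to k + 1, the new numerator A_r - A_{k+1} is exactly the step from
  \<open>node_factor k\<close> to \<open>node_factor (k + 1)\<close>.\<close>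

lemma m_quot_times_v:
  assumes "l \<le> k" "k < r"
  shows "P l * v l * (A r - A l) * (\<Prod>j=Suc l..k. (A r - A j) * inverse (A j - A l)) =
    node_factor k * (\<Prod>j=Suc l..k. inverse (A j - A l))"
  using assms
proof (induction k rule: dec_induct)
  case base
  then show ?case by (simp add: node_factor_def)
next
  case (step k)
  have "node_factor k * (A r - A (Suc k)) = node_factor (Suc k)"
    using step by (simp add: node_factor_eq[of k] node_factor_def[of "Suc k"] mult_ac)
  then show ?case using step by (simp add: mult_ac)
qed

text \<open>Separates A_r, the nodes left of A_l and those right of it; reversing the k - l
  differences on the right gives the sign.\<close>

lemma prod_nodes:
  assumes "l \<le> k" "k < r"
  shows "(\<Prod>z\<in>nodes k - {A l}. inverse (A l - z)) =
    inverse (A l - A r) * (\<Prod>i<l. inverse (A l - A i)) *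
      ((-1) ^ (k - l) * (\<Prod>j=Suc l..k. inverse (A j - A l)))"
proof -
  have "nodes k - {A l} = insert (A r) (A ` ({..<l} \<union> {Suc l..k}))"
    using assms by (auto simp: A_eq_iff)
  moreover have "A r \<notin> A ` ({..<l} \<union> {Suc l..k})"
    using assms by (auto simp: A_eq_iff)
  moreover have "inj_on A ({..<l} \<union> {Suc l..k})"
    using assms by (intro inj_on_subset[OF inj_on_A[of k]]) auto
  ultimately have "(\<Prod>z\<in>nodes k - {A l}. inverse (A l - z)) =
      inverse (A l - A r) * (\<Prod>i\<in>{..<l} \<union> {Suc l..k}. inverse (A l - A i))"
    by (simp add: prod.reindex)
  also have "(\<Prod>i\<in>{..<l} \<union> {Suc l..k}. inverse (A l - A i)) =
      (\<Prod>i<l. inverse (A l - A i)) * (\<Prod>j=Suc l..k. inverse (A l - A j))"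
    by (rule prod.union_disjoint) auto
  also have "(\<Prod>j=Suc l..k. inverse (A l - A j)) = (\<Prod>j=Suc l..k. (-1) * inverse (A j - A l))"
    by (intro prod.cong refl) (metis inverse_minus_eq minus_diff_eq mult_minus1)
  also have "\<dots> = (-1) ^ (k - l) * (\<Prod>j=Suc l..k. inverse (A j - A l))"
    by (simp only: prod.distrib prod_constant card_atLeastAtMost) simp
  finally show ?thesis by (simp add: mult.assoc)
qed

lemma f_quot_eq:
  assumes "1 \<le> l" "l \<le> k" "k < r"
  shows "(-1) ^ (k - l) * f_quot a k l = - node_factor k * (\<Prod>z\<in>nodes k - {A l}. inverse (A l - z))"
proof -
  let ?M = "\<Prod>j=Suc l..k. (A r - A j) * inverse (A j - A l)"
  let ?Q = "\<Prod>i<l. inverse (A l - A i)"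
  \<comment> \<open>For l = k the product is empty, in agreement with the separate case of
    \<open>f_quot\<close>.\<close>
  have "f_quot a k l = ?M * f_coeff a l"
    using assms by (simp add: f_quot_def m_quot_eq)
  also have "\<dots> = ?M * (P l * ?Q * v l)"
    using assms by (simp add: f_coeff_eq)
  \<comment> \<open>Inserts A_r - A_l, nonzero as l < r, and its inverse, the factor of the node A_r
    up to sign.\<close>
  also have "\<dots> = P l * v l * (A r - A l) * ?M * (inverse (A r - A l) * ?Q)"
    using assms A_eq_iff[of r l] by simp
  also have "\<dots> = node_factor k * (\<Prod>j=Suc l..k. inverse (A j - A l)) * (inverse (A r - A l) * ?Q)"
    using assms by (simp add: m_quot_times_v)
  also have "inverse (A r - A l) = - inverse (A l - A r)"
    by (metis inverse_minus_eq minus_diff_eq)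
  finally show ?thesis
    using assms by (simp add: prod_nodes mult_ac)
qed

section \<open>From coefficients to polynomials in y, and the final identity\<close>

definition tail :: "nat \<Rightarrow> 'a poly poly" where
  "tail k = (\<Sum>m=k+1..n. const_xy (tail_coeff k m) * (var_y - 1) ^ (m - k - 1))"

text \<open>\<open>tau_eq\<close> expands each tau in powers of y - 1 with coefficients (xi_l choose
  m), which vanish beyond xi_l, so all sums can run up to n. After l = k - h and an exchange of
  sums, \<open>f_quot_eq\<close> and \<open>tail_coeff_eq_sum\<close> match the
  coefficients.\<close>

lemma inner_sum_eq:
  assumes "1 \<le> k" "k < r"
  shows "(\<Sum>h=0..k-1. (-1) ^ h * const_xy (f_quot a k (k - h)) *
    tau (int k + 1) (int (xi a (k - h)) - int k - 1)) = tail k"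
proof -
  let ?Y = "var_y - 1 :: 'a poly poly"
  let ?c = "\<lambda>l. - node_factor k * (\<Prod>z\<in>nodes k - {A l}. inverse (A l - z))"
  have tau_xi: "tau (int k + 1) (int (xi a l) - int k - 1) =
      (\<Sum>m=k+1..n. of_nat (xi a l choose m) * ?Y ^ (m - k - 1))" if "l \<le> r" for l
  proof -
    have "xi a l \<le> n" using xi_mono[of l r] that by simp
    then have "(\<Sum>m=k+1..xi a l. of_nat (xi a l choose m) * ?Y ^ (m - k - 1)) =
        (\<Sum>m=k+1..n. of_nat (xi a l choose m) * ?Y ^ (m - k - 1))"
      by (intro sum.mono_neutral_left) auto
    then show ?thesis
      using tau_eq[of "k + 1" "xi a l", where 'a = 'a] by (simp add: algebra_simps)
  qed
  have "(\<Sum>h=0..k-1. (-1) ^ h * const_xy (f_quot a k (k - h)) *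
      tau (int k + 1) (int (xi a (k - h)) - int k - 1)) =
      (\<Sum>l=1..k. const_xy ((-1) ^ (k - l) * f_quot a k l) *
        tau (int k + 1) (int (xi a l) - int k - 1))"
    unfolding const_xy_minus_one_power
    by (rule sum.reindex_bij_witness[of _ "\<lambda>l. k - l" "\<lambda>h. k - h"]) (use assms in auto)
  also have "\<dots> = (\<Sum>l=1..k. const_xy (?c l) *
      (\<Sum>m=k+1..n. of_nat (xi a l choose m) * ?Y ^ (m - k - 1)))"
    using assms by (intro sum.cong refl) (simp add: f_quot_eq tau_xi)
  also have "\<dots> = (\<Sum>m=k+1..n. \<Sum>l=1..k. const_xy (?c l * of_nat (xi a l choose m)) * ?Y ^ (m - k - 1))"
    unfolding sum_distrib_left by (subst sum.swap) (simp add: const_xy_simps const_xy_of_nat mult.assoc)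
  also have "\<dots> = tail k"
    unfolding tail_def using assms
    by (intro sum.cong refl) (simp add: tail_coeff_eq_sum const_xy_sum sum_distrib_right)
  finally show ?thesis .
qed

text \<open>Lets the sums over k below start at 0 or at 1 alike.\<close>

lemma tail_0: "tail 0 = 0"
  by (simp add: tail_def tail_coeff_0 const_xy_simps)

definition x_coeff :: "nat \<Rightarrow> 'a poly poly" where
  "x_coeff j = (\<Sum>m=j..n. const_xy (xy_coeff j m) * (var_y - 1) ^ (m - j))"

lemma gamma_bar_eq_x_coeff: "gamma_bar n r a = (\<Sum>j\<le>r. (var_x - 1) ^ (r - j) * x_coeff j)"
proof -
  let ?t = "\<lambda>m j. const_xy (xy_coeff j m) * ((var_x - 1) ^ (r - j) * (var_y - 1) ^ (m - j))"
  have "gamma_bar n r a = (\<Sum>m\<le>n. \<Sum>j | j \<in> {..r} \<and> j \<le> m. ?t m j)"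
    unfolding gamma_bar_eq by (intro sum.cong) auto
  also have "\<dots> = (\<Sum>j\<le>r. \<Sum>m | m \<in> {..n} \<and> j \<le> m. ?t m j)"
    by (rule sum.swap_restrict) auto
  also have "\<dots> = (\<Sum>j\<le>r. (var_x - 1) ^ (r - j) * x_coeff j)"
    unfolding x_coeff_def sum_distrib_left by (intro sum.cong) (auto simp: mult_ac)
  finally show ?thesis .
qed

lemma x_coeff_0: "x_coeff 0 = const_xy (f_coeff a r)"
proof -
  have "x_coeff 0 = (\<Sum>m=0..n. if m = 0 then const_xy (f_coeff a r) else 0)"
    unfolding x_coeff_def by (intro sum.cong refl) (simp add: xy_coeff_0 const_xy_simps)
  then show ?thesis by simp
qed

text \<open>The coefficients for j - 1 sum to \<open>tail (j - 1)\<close>. For j the exponents are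
  one larger than in \<open>tail j\<close>, which gives the factor y - 1, and the additional term m
  = j is the diagonal one.\<close>

lemma x_coeff_eq:
  assumes "1 \<le> j" "j < r"
  shows "x_coeff j = const_xy (f_coeff a r) * of_nat (n choose j) + (var_y - 1) * tail j - tail (j - 1)"
proof -
  let ?Y = "var_y - 1 :: 'a poly poly"
  have "x_coeff j = (\<Sum>m=j..n. const_xy (tail_coeff j m) * ?Y ^ (m - j)) -
      (\<Sum>m=j..n. const_xy (tail_coeff (j - 1) m) * ?Y ^ (m - j))"
    unfolding x_coeff_def sum_subtractf[symmetric] using assms
    by (intro sum.cong refl) (simp add: xy_coeff_eq const_xy_simps algebra_simps)
  also have "(\<Sum>m=j..n. const_xy (tail_coeff (j - 1) m) * ?Y ^ (m - j)) = tail (j - 1)"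
    using assms by (simp add: tail_def)
  also have "(\<Sum>m=j..n. const_xy (tail_coeff j m) * ?Y ^ (m - j)) =
      const_xy (tail_coeff j j) + (\<Sum>m=j+1..n. const_xy (tail_coeff j m) * ?Y ^ (m - j))"
    using assms r_le_n by (simp add: sum.atLeast_Suc_atMost)
  also have "(\<Sum>m=j+1..n. const_xy (tail_coeff j m) * ?Y ^ (m - j)) = ?Y * tail j"
    unfolding tail_def sum_distrib_left
  proof (intro sum.cong refl)
    fix m assume "m \<in> {j+1..n}"
    then have "m - j = Suc (m - j - 1)" by auto
    then show "const_xy (tail_coeff j m) * ?Y ^ (m - j) = ?Y * (const_xy (tail_coeff j m) * ?Y ^ (m - j - 1))"
      by (metis mult.left_commute power_Suc)
  qed
  finally show ?thesis
    using assms by (simp add: tail_coeff_diagonal const_xy_simps const_xy_of_nat)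
qed

lemma x_coeff_r:
  "x_coeff r = const_xy (f_coeff a r) * (\<Sum>m=r..n. of_nat (n choose m) * (var_y - 1) ^ (m - r)) - tail (r - 1)"
proof -
  have "x_coeff r = (\<Sum>m=r..n. const_xy (f_coeff a r) * (of_nat (n choose m) * (var_y - 1) ^ (m - r))) -
      (\<Sum>m=r..n. const_xy (tail_coeff (r - 1) m) * (var_y - 1) ^ (m - r))"
    unfolding x_coeff_def sum_subtractf[symmetric]
    by (intro sum.cong refl) (simp add: xy_coeff_r const_xy_simps const_xy_of_nat algebra_simps)
  then show ?thesis
    using r_pos by (simp add: tail_def sum_distrib_left)
qed

lemma tutte_uniform_split:
  "tutte_uniform r n = (\<Sum>j<r. (var_x - 1) ^ (r - j) * of_nat (n choose j)) +
     (\<Sum>m=r..n. of_nat (n choose m) * (var_y - 1) ^ (m - r) :: 'a poly poly)"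
proof -
  have "{..n} = {..<r} \<union> {r..n}" using r_le_n by auto
  then have "tutte_uniform r n = (\<Sum>m\<in>{..<r} \<union> {r..n}. of_nat (n choose m) *
      ((var_x - 1) ^ (r - min m r) * (var_y - 1) ^ (m - min m r) :: 'a poly poly))"
    by (simp add: tutte_uniform_eq[OF r_le_n])
  also have "\<dots> = (\<Sum>m<r. of_nat (n choose m) *
      ((var_x - 1) ^ (r - min m r) * (var_y - 1) ^ (m - min m r))) + (\<Sum>m=r..n. of_nat (n choose m) *
      ((var_x - 1) ^ (r - min m r) * (var_y - 1) ^ (m - min m r)))"
    by (rule sum.union_disjoint) auto
  finally show ?thesis
    by (simp add: min_absorb1 min_absorb2 mult.commute)
qed

text \<open>\<open>tail k\<close> enters at j = k with (x - 1)^(r-k) (y - 1) and at j = k + 1 with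
  -(x - 1)^(r-k-1), together (x - 1)^(r-k-1) ((x - 1) (y - 1) - 1). The terms with f_r make up the
  Tutte polynomial.\<close>

lemma gamma_bar_formula:
  "gamma_bar n r a = const_xy (f_coeff a r) * tutte_uniform r n +
    (var_x * var_y - var_x - var_y) * (\<Sum>k=1..r-1. (var_x - 1) ^ (r - k - 1) * tail k)"
proof -
  let ?X = "var_x - 1 :: 'a poly poly" and ?Y = "var_y - 1 :: 'a poly poly"
  let ?F = "const_xy (f_coeff a r) :: 'a poly poly"
  let ?R = "\<Sum>k=1..r-1. ?X ^ (r - k - 1) * tail k"
  have x_coeff_lt: "?X ^ (r - j) * x_coeff j = ?F * (?X ^ (r - j) * of_nat (n choose j)) +
      (?X ^ (r - j) * (?Y * tail j) - (if j = 0 then 0 else ?X ^ (r - j) * tail (j - 1)))"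
    if "j < r" for j
    using that by (cases "j = 0") (simp_all add: x_coeff_0 tail_0 x_coeff_eq algebra_simps)
  have XY: "(\<Sum>j<r. ?X ^ (r - j) * (?Y * tail j)) = ?X * ?Y * ?R"
  proof -
    have "(\<Sum>j<r. ?X ^ (r - j) * (?Y * tail j)) = (\<Sum>j=1..r-1. ?X ^ (r - j) * (?Y * tail j))"
    proof (rule sum.mono_neutral_right)
      show "\<forall>j\<in>{..<r} - {1..r - 1}. ?X ^ (r - j) * (?Y * tail j) = 0"
      proof
        fix j assume "j \<in> {..<r} - {1..r - 1}"
        then have "j = 0" by auto
        then show "?X ^ (r - j) * (?Y * tail j) = 0" by (simp add: tail_0)
      qed
    qed auto
    also have "\<dots> = ?X * ?Y * ?R"
      unfolding sum_distrib_left
    proof (intro sum.cong refl)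
      fix j assume "j \<in> {1..r - 1}"
      then have "r - j = Suc (r - j - 1)" by auto
      then have "?X ^ (r - j) = ?X * ?X ^ (r - j - 1)" by (metis power_Suc)
      then show "?X ^ (r - j) * (?Y * tail j) = ?X * ?Y * (?X ^ (r - j - 1) * tail j)"
        by (simp add: mult_ac)
    qed
    finally show ?thesis .
  qed
  \<comment> \<open>Here k = j - 1; the term for k = r - 1 comes from
    \<open>x_coeff r\<close>.\<close>
  have shift: "(\<Sum>j<r. if j = 0 then 0 else ?X ^ (r - j) * tail (j - 1)) + tail (r - 1) = ?R"
  proof -
    obtain q where q: "r = Suc q" using r_pos by (cases r) auto
    have "(\<Sum>j<r. if j = 0 then 0 else ?X ^ (r - j) * tail (j - 1)) + tail (r - 1) =
        (\<Sum>k<q. ?X ^ (q - k) * tail k) + tail q"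
      unfolding q sum.lessThan_Suc_shift by simp
    also have "\<dots> = (\<Sum>k\<le>q. ?X ^ (q - k) * tail k)"
      by (simp flip: lessThan_Suc_atMost)
    also have "\<dots> = (\<Sum>k=1..q. ?X ^ (q - k) * tail k)"
      by (simp add: sum.atMost_shift tail_0 sum.atLeast1_atMost_eq)
    finally show ?thesis by (simp add: q)
  qed
  have sum_x_coeff: "(\<Sum>j<r. ?X ^ (r - j) * x_coeff j) = (\<Sum>j<r. ?F * (?X ^ (r - j) * of_nat (n choose j)) +
      (?X ^ (r - j) * (?Y * tail j) - (if j = 0 then 0 else ?X ^ (r - j) * tail (j - 1))))"
    by (intro sum.cong refl x_coeff_lt) simp
  have "gamma_bar n r a = (\<Sum>j<r. ?X ^ (r - j) * x_coeff j) + x_coeff r"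
    by (simp add: gamma_bar_eq_x_coeff flip: lessThan_Suc_atMost)
  also have "(\<Sum>j<r. ?X ^ (r - j) * x_coeff j) = ?F * (\<Sum>j<r. ?X ^ (r - j) * of_nat (n choose j)) +
      (?X * ?Y * ?R - (\<Sum>j<r. if j = 0 then 0 else ?X ^ (r - j) * tail (j - 1)))"
    by (simp only: sum_x_coeff sum.distrib sum_subtractf XY sum_distrib_left[symmetric])
  also have "\<dots> + x_coeff r = ?F * tutte_uniform r n + (?X * ?Y * ?R -
      ((\<Sum>j<r. if j = 0 then 0 else ?X ^ (r - j) * tail (j - 1)) + tail (r - 1)))"
    by (simp only: x_coeff_r tutte_uniform_split) (simp add: algebra_simps)
  also have "\<dots> = ?F * tutte_uniform r n + (var_x * var_y - var_x - var_y) * ?R"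
    unfolding shift by (simp add: algebra_simps)
  finally show ?thesis .
qed

end

theorem mainTheorem2:
  fixes a :: "nat list" and n r :: nat
  assumes "r \<ge> 1" and "composition n r a" and "a ! 0 = 0"
  shows "(gamma_bar n r a :: 'a::field_char_0 poly poly) =
    const_xy (f_coeff a r) * tutte_uniform r n +
    (var_x * var_y - var_x - var_y) *
      (\<Sum>k=1..r-1. (var_x - 1) ^ (r - k - 1) *
        (\<Sum>h=0..k-1. (-1) ^ h * const_xy (f_quot a k (k - h)) *
          tau (int k + 1) (int (xi a (k - h)) - int k - 1)))"
proof -
  interpret loopless_composition a n r "\<lambda>i. of_nat (xi a i) :: 'a" "\<lambda>i. of_nat (a ! i)"
    "\<lambda>k. 1 / nu (drop k (tl a))" "\<lambda>k. \<Prod>i=1..k. of_nat (a ! i)"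
    using assms by unfold_locales auto
  show ?thesis
    unfolding gamma_bar_formula
    by (intro arg_cong2[of _ _ _ _ "(+)"] arg_cong2[of _ _ _ _ "(*)"] sum.cong refl)
      (rule inner_sum_eq[symmetric]; auto)
qed

end
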